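(* Let $X$ be a distance-regular graph of diameter $d\geq 2$ with vertex degree $k$ and second largest eigenvalue $\theta_1$. Suppose that every neighborhood graph $X(v)$ is a disjoint union of $m$ cliques. Moreover, assume $\mu\geq 2$, that $c_t\leq \varepsilon k$ and $b_t\leq\varepsilon k$ for some $t\leq d$, and that $\theta_1\geq (1-\varepsilon)b_1$, where $0<\varepsilon<1/(6m^4d)$. Then $X$ is the Hamming graph $H(d,s)$ with $s=1+k/d$.
   Context: A connected graph $X$ of diameter $d$ is distance-regular if for each $0\le i\le d$ there are constants $a_i,b_i,c_i$ such that for any vertices $v,w$ at distance $i$, $w$ has exactly $c_i$, $a_i$, $b_i$ neighbors at distance $i-1$, $i$, $i+1$ from $v$; $k=b_0$, $\mu=c_2$. Its distinct adjacency eigenvalues are $k=\theta_0>\theta_1>\dots>\theta_d$. $X(v)$ is the subgraph induced on the neighbors of $v$. The Hamming graph $H(d,s)$ has vertices the $d$-tuples over an $s$-set, adjacent iff they differ in exactly one coordinate. *)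

theory Defs
  imports
    "Graph_Theory.Graph_Theory"
    "Jordan_Normal_Form.Char_Poly"
    "HOL-Library.Disjoint_Sets"
begin

text \<open>
  Finite simple graphs are rendered by \<^const>\<open>pair_graph\<close>: finite vertex set, symmetric and
  loop-free arc relation.
\<close>

text \<open>
  Number of edges of a shortest walk; only meaningful if \<open>u\<close> and \<open>v\<close> are joined by a walk.
\<close>
definition gdist :: "'a pair_pre_digraph \<Rightarrow> 'a \<Rightarrow> 'a \<Rightarrow> nat" where
  "gdist G u v = (LEAST n. \<exists>p. pre_digraph.awalk G u p v \<and> length p = n)"

definition diam :: "'a pair_pre_digraph \<Rightarrow> nat" where
  "diam G = Max {gdist G u v | u v. u \<in> pverts G \<and> v \<in> pverts G}"

text \<open>
  The values of \<open>c\<close>, \<open>a\<close>, \<open>b\<close> are determined exactly for arguments up to the diameter and are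
  unconstrained beyond it. Writing distance \<open>i - 1\<close> as \<open>gdist G v x + 1 = i\<close> avoids truncated
  subtraction, so that \<open>c 0 = 0\<close>.
\<close>
definition distance_regular_with ::
    "'a pair_pre_digraph \<Rightarrow> (nat \<Rightarrow> nat) \<Rightarrow> (nat \<Rightarrow> nat) \<Rightarrow> (nat \<Rightarrow> nat) \<Rightarrow> bool" where
  "distance_regular_with G c a b \<longleftrightarrow>
     pair_graph G \<and> connected G \<and>
     (\<forall>v\<in>pverts G. \<forall>w\<in>pverts G. \<forall>i. gdist G v w = i \<longrightarrow>
        card {x \<in> pverts G. (w, x) \<in> parcs G \<and> gdist G v x + 1 = i} = c i \<and>
        card {x \<in> pverts G. (w, x) \<in> parcs G \<and> gdist G v x = i} = a i \<and>
        card {x \<in> pverts G. (w, x) \<in> parcs G \<and> gdist G v x = i + 1} = b i)"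

definition adj_mat :: "'a pair_pre_digraph \<Rightarrow> 'a list \<Rightarrow> real mat" where
  "adj_mat G vs = mat (length vs) (length vs)
     (\<lambda>(i, j). if (vs ! i, vs ! j) \<in> parcs G then 1 else 0)"

text \<open>The spectrum does not depend on the enumeration \<open>vs\<close> of the vertices.\<close>
definition adj_eigenvalues :: "'a pair_pre_digraph \<Rightarrow> real set" where
  "adj_eigenvalues G =
     {\<theta>. \<exists>vs. distinct vs \<and> set vs = pverts G \<and> eigenvalue (adj_mat G vs) \<theta>}"

text \<open>The distinct eigenvalues in decreasing order, indexed from 0.\<close>
definition theta :: "'a pair_pre_digraph \<Rightarrow> nat \<Rightarrow> real" where
  "theta G i = rev (sorted_list_of_set (adj_eigenvalues G)) ! i"

definition neighborhood_graph ::
    "'a pair_pre_digraph \<Rightarrow> 'a \<Rightarrow> ('a, 'a \<times> 'a) pre_digraph" where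
  "neighborhood_graph G v = induce_subgraph (with_proj G) {w \<in> pverts G. (v, w) \<in> parcs G}"

text \<open>
  The blocks of \<open>P\<close> are the vertex sets of the cliques; they are nonempty and may differ in size.
\<close>
definition disjoint_union_of_cliques :: "('a, 'b) pre_digraph \<Rightarrow> nat \<Rightarrow> bool" where
  "disjoint_union_of_cliques H m \<longleftrightarrow>
     (\<exists>P. partition_on (verts H) P \<and> finite P \<and> card P = m \<and>
        arcs_ends H = {(u, w). u \<noteq> w \<and> (\<exists>C\<in>P. u \<in> C \<and> w \<in> C)})"

definition hamming_graph :: "nat \<Rightarrow> nat \<Rightarrow> nat list pair_pre_digraph" where
  "hamming_graph d s =
     (let V = {x. length x = d \<and> set x \<subseteq> {..<s}} in
      \<lparr> pverts = V,
        parcs = {(x, y). x \<in> V \<and> y \<in> V \<and> card {i. i < d \<and> x ! i \<noteq> y ! i} = 1} \<rparr>)"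

end

theory Submission
  imports Defs "Jordan_Normal_Form.Spectral_Radius"
begin

text \<open>
  The eigenvalue \<open>\<theta> = \<theta>\<^sub>1\<close> gives a spherical representation of the graph in which the inner product of
  two vertices at distance \<open>j\<close> is the cosine \<open>u j\<close>. Let \<open>\<sigma>\<close> be the size of the cliques in the
  neighbourhoods, so that \<open>k = m \<sigma>\<close>. The hypotheses on \<open>t\<close> give \<open>\<epsilon> k \<ge> 1\<close>, hence \<open>\<sigma>\<close> is
  large. A four-cycle forces \<open>\<theta> \<le> b\<^sub>1 - 1\<close>, and as \<open>\<theta> \<ge> (1 - \<epsilon>) b\<^sub>1\<close> all four-cycles are
  nearly parallelograms, which excludes \<open>\<mu> \<ge> 3\<close>. By induction on \<open>j\<close>, \<open>u j\<close> is close to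
  \<open>(m - j) / m\<close>, and for \<open>x\<close> and \<open>y\<close> at distance \<open>j\<close> the vector \<open>x - y\<close> is nearly the sum of \<open>j\<close> nearly
  orthogonal vectors \<open>z - y\<close>, for neighbours \<open>z\<close> of \<open>y\<close> closer to \<open>x\<close>. Up to a factor \<open>1 / m\<close> and a
  small error all inner products of edges are integers, so this determines the distance from \<open>x\<close> to every
  neighbour of \<open>y\<close> exactly: the graph has the intersection numbers of a Hamming graph with \<open>m = d\<close>, and every line
  has a unique vertex nearest to a given vertex. The nearest vertices on the lines through a fixed vertex
  are Hamming coordinates.
\<close>

section \<open>Distance-regular graphs and their cosine sequences\<close>

text \<open>Positivity and the hypothesis on \<theta> bound the same quantity from two sides. On a
  four-cycle the squared norm of \<open>x + y - z - z'\<close> is a positive multiple of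
  \<open>(1 + eta) * (ss * eta - 1)\<close>, where \<open>eta\<close> measures how far \<theta> lies
  below its ideal value; so \<open>ss * eta \<ge> 1\<close>, while \<theta> near \<open>b 1\<close>
  gives \<open>eta \<le> \<epsilon> * (m - 1)\<close>. The same identity then bounds the norm above
  by a multiple of \<epsilon>, so four-cycles are nearly flat. The obstacle is a circularity. The
  recurrence controls \<open>u (j + 1)\<close> only if the intersection numbers at \<open>j\<close>
  are known, and these come from the geometry at distance \<open>j\<close>, which is read off from
  \<open>u j\<close>. Both therefore advance together. The error of \<open>u j\<close> grows
  linearly in \<open>j\<close>, up to \<open>d\<close> steps, and the approximation of
  \<open>x - y\<close> involves up to \<open>m\<close> edges, hence up to \<open>m ^ 2\<close>
  pairs; the factor \<open>m ^ 4 * d\<close> in the bound on \<epsilon> pays for these sums. The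
  errors need not tend to zero: competing distances differ by a whole unit, so an error below a
  fixed fraction of a unit decides exactly. Once the distances are decided, no estimate remains and
  the coordinates are pure combinatorics.\<close>

locale drg =
  fixes V :: "'a set" and adj :: "'a \<Rightarrow> 'a \<Rightarrow> bool" and dst :: "'a \<Rightarrow> 'a \<Rightarrow> nat"
    and c a b :: "nat \<Rightarrow> nat" and d :: nat
  assumes fin: "finite V"
    and adj_sym: "adj x y \<Longrightarrow> adj y x"
    and adj_irrefl: "\<not> adj x x"
    and adj_V: "adj x y \<Longrightarrow> x \<in> V"
    and dst_0: "x \<in> V \<Longrightarrow> y \<in> V \<Longrightarrow> dst x y = 0 \<longleftrightarrow> x = y"
    and dst_sym: "x \<in> V \<Longrightarrow> y \<in> V \<Longrightarrow> dst x y = dst y x"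
    and dst_step: "x \<in> V \<Longrightarrow> adj y z \<Longrightarrow> dst x z \<le> dst x y + 1"
    and dst_pred: "x \<in> V \<Longrightarrow> y \<in> V \<Longrightarrow> dst x y = Suc n \<Longrightarrow> \<exists>z. adj z y \<and> dst x z = n"
    and dst_le: "x \<in> V \<Longrightarrow> y \<in> V \<Longrightarrow> dst x y \<le> d"
    and diam_attained: "\<exists>x\<in>V. \<exists>y\<in>V. dst x y = d"
    and card_c: "x \<in> V \<Longrightarrow> y \<in> V \<Longrightarrow> card {w. adj y w \<and> dst x w + 1 = dst x y} = c (dst x y)"
    and card_a: "x \<in> V \<Longrightarrow> y \<in> V \<Longrightarrow> card {w. adj y w \<and> dst x w = dst x y} = a (dst x y)"
    and card_b: "x \<in> V \<Longrightarrow> y \<in> V \<Longrightarrow> card {w. adj y w \<and> dst x w = dst x y + 1} = b (dst x y)"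
begin

lemma adj_V2: "adj x y \<Longrightarrow> y \<in> V"
  using adj_V adj_sym by blast

lemma adj_neq: "adj x y \<Longrightarrow> x \<noteq> y"
  using adj_irrefl by blast

lemma dst_refl [simp]: "x \<in> V \<Longrightarrow> dst x x = 0"
  by (simp add: dst_0)

lemma dst_step': "x \<in> V \<Longrightarrow> adj y z \<Longrightarrow> dst x y \<le> dst x z + 1"
  using dst_step adj_sym by blast

lemma dst_1: "x \<in> V \<Longrightarrow> y \<in> V \<Longrightarrow> dst x y = 1 \<longleftrightarrow> adj x y"
proof
  assume xy: "x \<in> V" "y \<in> V"
  { assume "dst x y = 1"
    then obtain z where "adj z y" "dst x z = 0" using dst_pred[OF xy, of 0] by auto
    then show "adj x y" using dst_0[of x z] xy adj_V[of z y] by auto }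
  { assume "adj x y"
    then have "dst x y \<le> 1" "dst x y \<noteq> 0"
      using dst_step[of x x y] dst_0[OF xy] xy adj_irrefl by auto
    then show "dst x y = 1" by simp }
qed

lemma adj_dst: "adj x y \<Longrightarrow> dst x y = 1"
  using dst_1 adj_V adj_V2 by blast

lemma dst_2:
  assumes "adj y x" "adj y z" "x \<noteq> z" "\<not> adj x z"
  shows "dst x z = 2"
proof -
  have xz: "x \<in> V" "z \<in> V" using assms adj_V2 by auto
  have "dst x z \<le> 2" using dst_step[OF xz(1) assms(2)] adj_dst[OF adj_sym[OF assms(1)]] by simp
  moreover have "dst x z \<noteq> 0" "dst x z \<noteq> 1" using assms dst_0[OF xz] dst_1[OF xz] by auto
  ultimately show ?thesis by simp
qed

lemma finite_nb [simp]: "finite {w. adj y w \<and> P w}"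
  by (rule finite_subset[OF _ fin]) (auto dest: adj_V2)

lemma finite_nb' [simp]: "finite {w. adj y w}"
  using finite_nb[of y "\<lambda>_. True"] by simp

lemma card_nb: "y \<in> V \<Longrightarrow> card {w. adj y w} = b 0"
proof -
  assume y: "y \<in> V"
  then have "{w. adj y w} = {w. adj y w \<and> dst y w = dst y y + 1}" using adj_dst by auto
  then show ?thesis using card_b[OF y y] y by simp
qed

lemma card_nb_split:
  assumes "x \<in> V" "y \<in> V"
  shows "c (dst x y) + a (dst x y) + b (dst x y) = b 0"
proof -
  let ?i = "dst x y"
  let ?C = "{w. adj y w \<and> dst x w + 1 = ?i}" and ?A = "{w. adj y w \<and> dst x w = ?i}"
    and ?B = "{w. adj y w \<and> dst x w = ?i + 1}"
  have "{w. adj y w} = ?C \<union> ?A \<union> ?B"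
    using dst_step[OF assms(1)] dst_step'[OF assms(1)] by (fastforce simp: le_Suc_eq)
  then have "b 0 = card (?C \<union> ?A \<union> ?B)" using card_nb assms by metis
  also have "\<dots> = card (?C \<union> ?A) + card ?B" by (rule card_Un_disjoint) auto
  also have "card (?C \<union> ?A) = card ?C + card ?A" by (rule card_Un_disjoint) auto
  finally show ?thesis using card_a[OF assms] card_b[OF assms] card_c[OF assms] by simp
qed

lemma dst_attained:
  assumes "i \<le> d" shows "\<exists>x\<in>V. \<exists>y\<in>V. dst x y = i"
proof -
  have "\<exists>x\<in>V. \<exists>y\<in>V. dst x y = d - n" if "n \<le> d" for n
    using that
  proof (induction n)
    case 0 then show ?case using diam_attained by simp
  next
    case (Suc n)
    then obtain x y where "x \<in> V" "y \<in> V" "dst x y = Suc (d - Suc n)"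
      by (metis Suc_diff_Suc Suc_leD Suc_le_eq)
    then show ?case using dst_pred[of x y] adj_V by blast
  qed
  from this[of "d - i"] show ?thesis using assms by simp
qed

lemma c_0: "c 0 = 0"
proof -
  obtain x where x: "x \<in> V" using diam_attained by blast
  have "{w. adj x w \<and> dst x w + 1 = dst x x} = {}" using x by auto
  then show ?thesis using card_c[OF x x] x by (metis card.empty dst_refl)
qed

lemma c_pos: "0 < i \<Longrightarrow> i \<le> d \<Longrightarrow> 0 < c i"
proof -
  assume i: "0 < i" "i \<le> d"
  obtain x y where xy: "x \<in> V" "y \<in> V" "dst x y = i" using dst_attained[OF i(2)] by auto
  obtain z where "adj z y" "dst x z = i - 1" using dst_pred[OF xy(1,2), of "i - 1"] xy(3) i by auto
  then have "{w. adj y w \<and> dst x w + 1 = dst x y} \<noteq> {}" using adj_sym xy i by fastforce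
  then have "card {w. adj y w \<and> dst x w + 1 = dst x y} \<noteq> 0" by simp
  then show ?thesis using card_c[OF xy(1,2)] xy(3) by (metis neq0_conv)
qed

lemma b_pos: "i < d \<Longrightarrow> 0 < b i"
proof -
  assume i: "i < d"
  obtain x y where xy: "x \<in> V" "y \<in> V" "dst x y = Suc i" using dst_attained[of "Suc i"] i by auto
  obtain z where z: "adj z y" "dst x z = i" using dst_pred[OF xy] by auto
  then have zV: "z \<in> V" using adj_V by auto
  have "y \<in> {w. adj z w \<and> dst x w = dst x z + 1}" using z xy by simp
  then have "card {w. adj z w \<and> dst x w = dst x z + 1} \<noteq> 0" by auto
  then show ?thesis using card_b[OF xy(1) zV] z(2) by (metis neq0_conv)
qed

lemma c_1: "1 \<le> d \<Longrightarrow> c 1 = 1"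
proof -
  assume "1 \<le> d"
  then obtain x y where xy: "x \<in> V" "y \<in> V" "dst x y = 1" using dst_attained by blast
  then have "{w. adj y w \<and> dst x w + 1 = dst x y} = {x}"
    using dst_0 dst_1[OF xy(1,2)] adj_sym adj_V2 by auto
  then show ?thesis using card_c[OF xy(1,2)] xy(3) by (metis card_1_singleton_iff One_nat_def)
qed

lemma a_0: "a 0 = 0"
proof -
  obtain x where x: "x \<in> V" using diam_attained by blast
  then have "{w. adj x w \<and> dst x w = dst x x} = {}" using adj_dst by auto
  then show ?thesis using card_a[OF x x] x by (metis card.empty dst_refl)
qed

lemma b_d: "b d = 0"
proof -
  obtain x y where xy: "x \<in> V" "y \<in> V" "dst x y = d" using diam_attained by auto
  then have "{w. adj y w \<and> dst x w = dst x y + 1} = {}" using dst_le[OF xy(1)] adj_V2 by fastforce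
  then show ?thesis using card_b[OF xy(1,2)] xy(3) by (metis card.empty)
qed

section \<open>Eigenfunctions, sphere sums and the cosine sequence\<close>

definition eigenfunction :: "real \<Rightarrow> ('a \<Rightarrow> real) \<Rightarrow> bool" where
  "eigenfunction \<theta> h \<longleftrightarrow> (\<forall>y\<in>V. (\<Sum>w | adj y w. h w) = \<theta> * h y)"

definition sphere_sum :: "('a \<Rightarrow> real) \<Rightarrow> nat \<Rightarrow> 'a \<Rightarrow> real" where
  "sphere_sum h i x = (\<Sum>y\<in>V. if dst x y = i then h y else 0)"

text \<open>Double counting of adjacent pairs \<open>y\<close>, \<open>w\<close> with
  \<open>y\<close> on the sphere of radius \<open>i\<close> around \<open>x\<close>: a fixed
  \<open>w\<close> is counted once for each neighbour on that sphere, so \<open>a i\<close>,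
  \<open>c (i + 1)\<close> or \<open>b (i - 1)\<close> times according to its own distance from
  \<open>x\<close>. At \<open>i = d\<close> the next sphere is empty, which later closes the
  recurrence.\<close>

lemma sphere_sum_rec:
  assumes h: "eigenfunction \<theta> h" and x: "x \<in> V"
  shows "\<theta> * sphere_sum h i x = real (a i) * sphere_sum h i x
    + real (c (i + 1)) * sphere_sum h (i + 1) x
    + (if i = 0 then 0 else real (b (i - 1)) * sphere_sum h (i - 1) x)"
proof -
  have card: "real (card {y. adj w y \<and> dst x y = i}) =
      (if dst x w = i then real (a i) else 0) + (if dst x w = i + 1 then real (c (i + 1)) else 0)
      + (if i = 0 then 0 else if dst x w = i - 1 then real (b (i - 1)) else 0)"
    if w: "w \<in> V" for w
  proof -
    consider "dst x w = i" | "dst x w = i + 1" | "i \<noteq> 0" "dst x w = i - 1"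
      | "dst x w \<noteq> i" "dst x w \<noteq> i + 1" "i = 0 \<or> dst x w \<noteq> i - 1" by (cases "i = 0") auto
    then show ?thesis
    proof cases
      case 1 then show ?thesis using card_a[OF x w] by auto
    next
      case 2 then show ?thesis using card_c[OF x w] by auto
    next
      case 3 then show ?thesis using card_b[OF x w] by auto
    next
      case 4
      then have "{y. adj w y \<and> dst x y = i} = {}"
        using dst_step[OF x, of w] dst_step'[OF x, of w] by (fastforce simp: le_Suc_eq)
      then show ?thesis using 4 by auto
    qed
  qed
  have "\<theta> * sphere_sum h i x = (\<Sum>y\<in>V. if dst x y = i then \<theta> * h y else 0)"
    unfolding sphere_sum_def sum_distrib_left by (rule sum.cong) auto
  also have "\<dots> = (\<Sum>y\<in>V. \<Sum>w\<in>V. if adj w y \<and> dst x y = i then h w else 0)"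
  proof (rule sum.cong[OF refl])
    fix y assume y: "y \<in> V"
    have "\<theta> * h y = (\<Sum>w | adj y w. h w)" using h y unfolding eigenfunction_def by simp
    also have "\<dots> = (\<Sum>w \<in> {w \<in> V. adj w y}. h w)"
      by (rule sum.cong) (auto dest: adj_sym adj_V2)
    also have "\<dots> = (\<Sum>w\<in>V. if adj w y then h w else 0)" by (simp add: sum.inter_filter fin)
    finally show "(if dst x y = i then \<theta> * h y else 0)
        = (\<Sum>w\<in>V. if adj w y \<and> dst x y = i then h w else 0)"
      by auto
  qed
  also have "\<dots> = (\<Sum>w\<in>V. \<Sum>y\<in>V. if adj w y \<and> dst x y = i then h w else 0)"
    by (rule sum.swap)
  also have "\<dots> = (\<Sum>w\<in>V. h w * real (card {y. adj w y \<and> dst x y = i}))"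
  proof (rule sum.cong[OF refl])
    fix w assume "w \<in> V"
    have "{y \<in> V. adj w y \<and> dst x y = i} = {y. adj w y \<and> dst x y = i}" by (auto dest: adj_V2)
    then show "(\<Sum>y\<in>V. if adj w y \<and> dst x y = i then h w else 0)
      = h w * real (card {y. adj w y \<and> dst x y = i})"
      by (simp add: sum.inter_filter[OF fin, symmetric])
  qed
  also have "\<dots> = (\<Sum>w\<in>V. real (a i) * (if dst x w = i then h w else 0)
      + real (c (i + 1)) * (if dst x w = i + 1 then h w else 0)
      + (if i = 0 then 0 else real (b (i - 1)) * (if dst x w = i - 1 then h w else 0)))"
    by (rule sum.cong) (auto simp: card)
  finally show ?thesis
    unfolding sphere_sum_def by (simp add: sum.distrib sum_distrib_left)
qed

text \<open>The value at \<theta> of the polynomial that expresses the distance-\<open>i\<close>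
  matrix in terms of the adjacency matrix; the clauses are \<open>sphere_sum_rec\<close> solved for
  the next sphere.\<close>

fun sphere_poly :: "real \<Rightarrow> nat \<Rightarrow> real" where
  "sphere_poly \<theta> 0 = 1"
| "sphere_poly \<theta> (Suc 0) = \<theta> / real (c 1)"
| "sphere_poly \<theta> (Suc (Suc i)) = ((\<theta> - real (a (Suc i))) * sphere_poly \<theta> (Suc i)
      - real (b i) * sphere_poly \<theta> i) / real (c (Suc (Suc i)))"

lemma sphere_sum_0: "x \<in> V \<Longrightarrow> sphere_sum h 0 x = h x"
proof -
  assume x: "x \<in> V"
  have "sphere_sum h 0 x = (\<Sum>y\<in>V. if y = x then h y else 0)"
    unfolding sphere_sum_def by (rule sum.cong) (use x dst_0 in auto)
  then show ?thesis using x fin by simp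
qed

lemma sphere_sum_poly:
  assumes h: "eigenfunction \<theta> h" and x: "x \<in> V" and "i \<le> d"
  shows "sphere_sum h i x = sphere_poly \<theta> i * h x"
  using \<open>i \<le> d\<close>
proof (induction i rule: less_induct)
  case (less i)
  consider "i = 0" | "i = 1" | j where "i = Suc (Suc j)" by (metis One_nat_def not0_implies_Suc)
  then show ?case
  proof cases
    case 1 then show ?thesis using sphere_sum_0[OF x] by simp
  next
    case 2
    then show ?thesis using sphere_sum_rec[OF h x, of 0] sphere_sum_0[OF x] c_1 less.prems a_0
      by simp
  next
    case 3
    then have cp: "c (Suc (Suc j)) > 0" using c_pos less.prems by simp
    have "sphere_sum h (Suc j) x = sphere_poly \<theta> (Suc j) * h x"
      "sphere_sum h j x = sphere_poly \<theta> j * h x" using 3 less by auto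
    then show ?thesis using sphere_sum_rec[OF h x, of "Suc j"] 3 cp
      by (simp add: field_simps)
  qed
qed

text \<open>The product formula for the number of vertices at distance \<open>i\<close>, taken as
  the definition so that no sphere has to be counted.\<close>

definition sphere_size :: "nat \<Rightarrow> real" where
  "sphere_size i = (\<Prod>l<i. real (b l) / real (c (Suc l)))"

lemma sphere_size_pos: "i \<le> d \<Longrightarrow> sphere_size i > 0"
  unfolding sphere_size_def by (rule prod_pos) (use b_pos c_pos in auto)

lemma sphere_size_Suc: "Suc i \<le> d \<Longrightarrow> real (c (Suc i)) * sphere_size (Suc i) = real (b i) * sphere_size i"
  using c_pos[of "Suc i"] by (simp add: sphere_size_def)

definition cosine :: "real \<Rightarrow> nat \<Rightarrow> real" where
  "cosine \<theta> i = sphere_poly \<theta> i / sphere_size i"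

lemma cosine_0: "cosine \<theta> 0 = 1"
  by (simp add: cosine_def sphere_size_def)

lemma cosine_1: "1 \<le> d \<Longrightarrow> real (b 0) * cosine \<theta> 1 = \<theta>"
  using b_pos[of 0] c_1 by (simp add: cosine_def sphere_size_def)

text \<open>Below the diameter this is the recurrence of \<open>sphere_poly\<close> after
  normalisation. At \<open>i = d\<close> it becomes a polynomial equation for \<theta>, and here the
  eigenfunction decides: its sum over the empty sphere of radius \<open>d + 1\<close> vanishes, and
  \<open>h x0 \<noteq> 0\<close> can be cancelled.\<close>

lemma cosine_rec:
  assumes h: "eigenfunction \<theta> h" and x0: "x0 \<in> V" "h x0 \<noteq> 0" and i: "1 \<le> i" "i \<le> d"
  shows "real (c i) * cosine \<theta> (i - 1) + real (a i) * cosine \<theta> i + real (b i) * cosine \<theta> (i + 1)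
    = \<theta> * cosine \<theta> i"
proof -
  obtain j where j: "i = Suc j" using i by (cases i) auto
  have pos: "sphere_size j > 0" "sphere_size (Suc j) > 0" using i j sphere_size_pos by auto
  have s: "real (c (Suc j)) * sphere_size (Suc j) = real (b j) * sphere_size j"
    using sphere_size_Suc i j by simp
  have cs: "real (c (Suc j)) * cosine \<theta> j = real (b j) * sphere_poly \<theta> j / sphere_size (Suc j)"
    using s pos by (simp add: cosine_def field_simps)
  have main: "real (b j) * sphere_poly \<theta> j + real (a i) * sphere_poly \<theta> i
    + real (b i) * cosine \<theta> (i + 1) * sphere_size i = \<theta> * sphere_poly \<theta> i"
  proof (cases "i = d")
    case True
    have z: "sphere_sum h (Suc i) x0 = 0"
      unfolding sphere_sum_def by (rule sum.neutral) (use True dst_le[OF x0(1)] in fastforce)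
    have "\<theta> * sphere_poly \<theta> i * h x0 = (real (a i) * sphere_poly \<theta> i + real (b j) * sphere_poly \<theta> j) * h x0"
      using sphere_sum_rec[OF h x0(1), of i] z sphere_sum_poly[OF h x0(1)] i j
      by (simp add: algebra_simps)
    then have "\<theta> * sphere_poly \<theta> i = real (a i) * sphere_poly \<theta> i + real (b j) * sphere_poly \<theta> j"
      using x0(2) by simp
    then show ?thesis using b_d True by simp
  next
    case False
    then have i': "Suc i \<le> d" using i by simp
    have "real (b i) * cosine \<theta> (i + 1) * sphere_size i = real (c (Suc i)) * sphere_poly \<theta> (Suc i)"
      using sphere_size_Suc[OF i'] sphere_size_pos[OF i'] sphere_size_pos[OF i(2)]
      by (simp add: cosine_def field_simps)
    moreover have "real (c (Suc i)) * sphere_poly \<theta> (Suc i)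
        = (\<theta> - real (a i)) * sphere_poly \<theta> i - real (b j) * sphere_poly \<theta> j"
      using c_pos[of "Suc i"] i' j by simp
    ultimately show ?thesis by (simp add: algebra_simps)
  qed
  have "sphere_size i * (real (c i) * cosine \<theta> (i - 1) + real (a i) * cosine \<theta> i + real (b i) * cosine \<theta> (i + 1))
    = real (b j) * sphere_poly \<theta> j + real (a i) * sphere_poly \<theta> i
    + real (b i) * cosine \<theta> (i + 1) * sphere_size i"
    using cs pos j by (simp add: cosine_def[of _ "Suc j"] algebra_simps)
  also have "\<dots> = sphere_size i * (\<theta> * cosine \<theta> i)"
    unfolding main using pos j by (simp add: cosine_def)
  finally show ?thesis using pos j by simp
qed

lemma cosine_row_eigen:
  assumes h: "eigenfunction \<theta> h" and x0: "x0 \<in> V" "h x0 \<noteq> 0" and d: "1 \<le> d" and x: "x \<in> V"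
  shows "eigenfunction \<theta> (\<lambda>y. cosine \<theta> (dst x y))"
  unfolding eigenfunction_def
proof
  fix y assume y: "y \<in> V"
  let ?u = "cosine \<theta>" and ?i = "dst x y"
  have "(\<Sum>w | adj y w. ?u (dst x w)) =
    (\<Sum>w | adj y w. (if dst x w + 1 = ?i then ?u (?i - 1) else 0)
      + (if dst x w = ?i then ?u ?i else 0) + (if dst x w = ?i + 1 then ?u (?i + 1) else 0))"
  proof (rule sum.cong[OF refl])
    fix w assume "w \<in> {w. adj y w}"
    then have w: "adj y w" by simp
    have "dst x w \<le> ?i + 1" "?i \<le> dst x w + 1"
      using dst_step[OF x w] dst_step'[OF x w] by auto
    then consider "dst x w + 1 = ?i" | "dst x w = ?i" | "dst x w = ?i + 1" by linarith
    then show "?u (dst x w) = (if dst x w + 1 = ?i then ?u (?i - 1) else 0)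
      + (if dst x w = ?i then ?u ?i else 0) + (if dst x w = ?i + 1 then ?u (?i + 1) else 0)"
    proof cases
      case 1
      then have "dst x w = ?i - 1" "dst x w \<noteq> ?i" "dst x w \<noteq> ?i + 1" by auto
      then show ?thesis using 1 by simp
    qed auto
  qed
  also have "\<dots> = real (c ?i) * ?u (?i - 1) + real (a ?i) * ?u ?i + real (b ?i) * ?u (?i + 1)"
    unfolding sum.distrib
    by (simp add: sum.inter_filter[symmetric] card_c[OF x y, simplified] card_a[OF x y]
        card_b[OF x y, simplified])
  also have "\<dots> = \<theta> * ?u ?i"
  proof (cases "?i = 0")
    case True then show ?thesis using cosine_1[OF d] c_0 a_0 cosine_0 by simp
  next
    case False
    then show ?thesis using cosine_rec[OF h x0, of ?i] dst_le[OF x y] by simp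
  qed
  finally show "(\<Sum>w | adj y w. ?u (dst x w)) = \<theta> * ?u ?i" .
qed

text \<open>The matrix \<open>U\<close> with entries \<open>cosine \<theta> (dst x y)\<close> is a
  multiple of a projection: its rows are eigenfunctions, so weighting the spheres around
  \<open>y\<close> by cosines returns a row times \<open>K\<close>. A symmetric \<open>U\<close>
  with \<open>U * U = K * U\<close> is the Gram matrix of its own rows divided by
  \<open>sqrt K\<close>, so no diagonalisation is required.\<close>

lemma cosine_gram:
  assumes h: "eigenfunction \<theta> h" and x0: "x0 \<in> V" "h x0 \<noteq> 0" and d: "1 \<le> d"
  obtains r :: "'a \<Rightarrow> 'a \<Rightarrow> real"
  where "\<And>x y. x \<in> V \<Longrightarrow> y \<in> V \<Longrightarrow> (\<Sum>z\<in>V. r x z * r y z) = cosine \<theta> (dst x y)"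
proof -
  let ?u = "cosine \<theta>"
  define K where "K = (\<Sum>i\<le>d. ?u i * sphere_poly \<theta> i)"
  have eq: "?u i * sphere_poly \<theta> i = sphere_size i * (?u i)\<^sup>2" if "i \<le> d" for i
    using sphere_size_pos[OF that] by (simp add: cosine_def power2_eq_square)
  \<comment> \<open>All terms are squares weighted by sphere sizes, and the term at 0 is 1; this
    makes \<open>sqrt K\<close> a legitimate divisor.\<close>
  have "K \<ge> (\<Sum>i\<in>{0}. ?u i * sphere_poly \<theta> i)" unfolding K_def
    by (rule sum_mono2) (use eq sphere_size_pos less_imp_le in \<open>auto intro!: mult_nonneg_nonneg\<close>)
  then have K: "K \<ge> 1" by (simp add: cosine_0)
  have "(\<Sum>z\<in>V. ?u (dst x z) * ?u (dst y z)) = K * ?u (dst x y)" if xy: "x \<in> V" "y \<in> V" for x y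
  proof -
    let ?h = "\<lambda>z. ?u (dst x z)"
    have "(\<Sum>z\<in>V. ?u (dst x z) * ?u (dst y z)) =
      (\<Sum>z\<in>V. \<Sum>i\<le>d. ?u i * (if dst y z = i then ?h z else 0))"
    proof (rule sum.cong[OF refl])
      fix z assume "z \<in> V"
      then have "dst y z \<le> d" using dst_le xy by simp
      have "(\<Sum>i\<le>d. ?u i * (if dst y z = i then ?h z else 0)) =
        (\<Sum>i\<le>d. if dst y z = i then ?u i * ?h z else 0)" by (rule sum.cong) auto
      also have "\<dots> = ?u (dst y z) * ?h z" using \<open>dst y z \<le> d\<close> by simp
      finally show "?u (dst x z) * ?u (dst y z) = (\<Sum>i\<le>d. ?u i * (if dst y z = i then ?h z else 0))"
        by simp
    qed
    also have "\<dots> = (\<Sum>i\<le>d. ?u i * sphere_sum ?h i y)"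
      unfolding sphere_sum_def sum_distrib_left by (rule sum.swap)
    also have "\<dots> = (\<Sum>i\<le>d. ?u i * sphere_poly \<theta> i * ?h y)"
      by (rule sum.cong[OF refl])
        (use sphere_sum_poly[OF cosine_row_eigen[OF h x0 d xy(1)] xy(2)] in simp)
    also have "\<dots> = K * ?u (dst x y)" unfolding K_def sum_distrib_right ..
    finally show ?thesis .
  qed
  then have "(\<Sum>z\<in>V. (?u (dst x z) / sqrt K) * (?u (dst y z) / sqrt K)) = ?u (dst x y)"
    if "x \<in> V" "y \<in> V" for x y
    using that K by (simp add: sum_divide_distrib[symmetric])
  then show ?thesis by (rule that[of "\<lambda>x z. ?u (dst x z) / sqrt K"])
qed

end

section \<open>Cliques of the local graphs and the defect of four-cycles\<close>

text \<open>Used with \<open>M = m - j\<close>, \<open>e = \<epsilon> * m\<close> and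
  \<open>h'\<close>, \<open>h\<close>, \<open>h2\<close> the drifts at \<open>j - 1\<close>,
  \<open>j\<close>, \<open>j + 1\<close>. The coefficient \<open>M - 1\<close> of \<open>h\<close>,
  compared with \<open>M\<close>, gains \<open>3 / 2 * (j * e)\<close>; the term with
  \<open>j / \<sigma>\<close> costs at most \<open>17 / 16 * (j * e)\<close>, and the remaining
  \<open>7 / 16\<close> covers the loss from \<open>\<eta> * h\<close>. The term
  \<open>\<eta> * M\<close> costs at most \<open>e * M\<close>, less than the allowed growth of
  \<open>3 / 2 * e\<close> per step.\<close>

lemma drift_step:
  fixes M j \<eta> e \<sigma> h h' h2 :: real
  assumes "M \<ge> 1" "j \<ge> 1" "0 \<le> \<eta>" "\<eta> \<le> e" "0 < \<sigma>" "1 / \<sigma> \<le> e" "j * e \<le> 1 / 48"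
    and h: "\<bar>h\<bar> \<le> 3 / 2 * (j * e)" and h': "\<bar>h'\<bar> \<le> 3 / 2 * ((j - 1) * e)"
    and rec: "M * h2 = (M - 1 - \<eta>) * h - \<eta> * M - j / \<sigma> * (1 + h' - h)"
  shows "\<bar>h2\<bar> \<le> 3 / 2 * ((j + 1) * e)"
proof -
  have e: "0 \<le> e" using assms by linarith
  have je: "0 \<le> j * e" using assms e by simp
  have "(j - 1) * e \<le> j * e" using e by (simp add: algebra_simps)
  then have hb: "\<bar>h\<bar> \<le> 1 / 32" "\<bar>h'\<bar> \<le> 1 / 32" using h h' assms by linarith+
  have "\<eta> \<le> j * e" using assms mult_right_mono[of 1 j e] e by linarith
  then have eta: "\<eta> \<le> 1 / 48" using assms by linarith
  have t1: "\<bar>(M - 1 - \<eta>) * h\<bar> \<le> (M - 1 + \<eta>) * (3 / 2 * (j * e))"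
    unfolding abs_mult by (rule mult_mono) (use assms h in auto)
  have "\<eta> * M \<le> e * M" using assms by (intro mult_right_mono) auto
  then have t2: "\<bar>\<eta> * M\<bar> \<le> e * M" using assms by simp
  have "j * (1 / \<sigma>) \<le> j * e" using assms by (intro mult_left_mono) auto
  then have "\<bar>j / \<sigma>\<bar> \<le> j * e" using assms by simp
  then have t3: "\<bar>j / \<sigma> * (1 + h' - h)\<bar> \<le> j * e * (17 / 16)"
    unfolding abs_mult by (rule mult_mono) (use hb je in auto)
  have "\<bar>M * h2\<bar> \<le> (M - 1 + \<eta>) * (3 / 2 * (j * e)) + e * M + j * e * (17 / 16)"
    unfolding rec using t1 t2 t3 by linarith
  also have "\<dots> = M * (3 / 2 * (j * e)) + e * M + (3 / 2 * \<eta> - 7 / 16) * (j * e)"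
    by (simp add: field_simps)
  also have "\<dots> \<le> M * (3 / 2 * (j * e)) + e * M + 0"
    using eta je by (intro add_left_mono mult_nonpos_nonneg) auto
  also have "\<dots> \<le> M * (3 / 2 * ((j + 1) * e))"
  proof -
    have "0 \<le> e * M" using e assms by simp
    then show ?thesis by (simp add: algebra_simps)
  qed
  finally have "\<bar>M * h2\<bar> \<le> M * (3 / 2 * ((j + 1) * e))" .
  moreover have "\<bar>M * h2\<bar> = M * \<bar>h2\<bar>" using assms(1) by (simp add: abs_mult)
  ultimately have "M * \<bar>h2\<bar> \<le> M * (3 / 2 * ((j + 1) * e))" by (simp only:)
  then show ?thesis using assms by (simp only: mult_le_cancel_left_pos)
qed

text \<open>\<open>clique_trans\<close> is the working form of the neighbourhood hypothesis: inside
  one neighbourhood, being adjacent or equal is transitive. A clique of the neighbourhood of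
  \<open>v\<close>, together with \<open>v\<close>, is a line through \<open>v\<close>.\<close>

locale local_cliques = drg +
  fixes m \<sigma> :: nat
  assumes clique_trans: "\<lbrakk>adj v x; adj v y; adj v z; adj x y; adj y z; x \<noteq> z\<rbrakk> \<Longrightarrow> adj x z"
    and a_1: "a 1 + 1 = \<sigma>"
    and b_0: "b 0 = m * \<sigma>"
    and d2: "2 \<le> d"
    and c2: "2 \<le> c 2"
begin

lemma card_adj2:
  assumes "adj y z" shows "card {w. adj y w \<and> adj z w} + 1 = \<sigma>"
proof -
  have V: "y \<in> V" "z \<in> V" "dst z y = 1" using assms adj_V adj_V2 adj_dst adj_sym by auto
  have "{w. adj y w \<and> dst z w = dst z y} = {w. adj y w \<and> adj z w}"
  proof (intro Collect_cong conj_cong refl)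
    fix w assume "adj y w"
    then show "dst z w = dst z y \<longleftrightarrow> adj z w" using dst_1[of z w] V adj_V2 by metis
  qed
  then show ?thesis using card_a[OF V(2,1)] V(3) a_1 by simp
qed

lemma b_1: "1 + \<sigma> + b 1 = m * \<sigma> + 1"
proof -
  obtain x y where xy: "x \<in> V" "y \<in> V" "dst x y = 1" using dst_attained[of 1] d2 by auto
  show ?thesis using card_nb_split[OF xy(1,2)] xy(3) c_1 a_1 b_0 d2 by simp
qed

lemma sigma_pos: "1 \<le> \<sigma>" using a_1 by simp

lemma m2: "2 \<le> m"
proof (rule ccontr)
  assume "\<not> 2 \<le> m"
  then consider "m = 0" | "m = 1" by linarith
  then show False using b_1 b_pos[of 1] d2 sigma_pos by cases auto
qed

text \<open>Each \<open>z\<close> forms, with its common neighbours with \<open>y\<close>, a clique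
  of \<sigma> vertices, and by transitivity the cliques of distinct nonadjacent \<open>z\<close> are
  disjoint.\<close>

lemma card_cliques:
  assumes Z: "Z \<subseteq> {z. adj y z}" "\<And>z z'. z \<in> Z \<Longrightarrow> z' \<in> Z \<Longrightarrow> \<not> adj z z'"
  shows "card {w. adj y w \<and> (w \<in> Z \<or> (\<exists>z\<in>Z. adj z w))} = card Z * \<sigma>"
proof -
  have finZ: "finite Z" using Z(1) finite_subset finite_nb' by blast
  let ?C = "\<lambda>z. insert z {w. adj y w \<and> adj z w}"
  have "{w. adj y w \<and> (w \<in> Z \<or> (\<exists>z\<in>Z. adj z w))} = (\<Union>z\<in>Z. ?C z)" using Z(1) by auto
  also have "card \<dots> = (\<Sum>z\<in>Z. card (?C z))"
  proof (rule card_UN_disjoint[OF finZ])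
    show "\<forall>z\<in>Z. \<forall>z'\<in>Z. z \<noteq> z' \<longrightarrow> ?C z \<inter> ?C z' = {}"
      using Z clique_trans[of y] adj_sym by blast
  qed simp
  also have "\<dots> = (\<Sum>z\<in>Z. \<sigma>)"
  proof (rule sum.cong[OF refl])
    fix z assume "z \<in> Z"
    then show "card (?C z) = \<sigma>" using Z(1) card_adj2[of y z] adj_irrefl by auto
  qed
  finally show ?thesis by simp
qed

definition closer :: "'a \<Rightarrow> 'a \<Rightarrow> 'a set" where
  "closer x y = {w. adj y w \<and> dst x w + 1 = dst x y}"

text \<open>The local picture in a Hamming graph: a line through \<open>y\<close> changes one
  coordinate. If \<open>x\<close> and \<open>y\<close> disagree there, exactly one point of the line
  repairs it and the others keep the distance; if they agree, every move increases the
  distance.\<close>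

definition regular_at :: "'a \<Rightarrow> 'a \<Rightarrow> bool" where
  "regular_at x y \<longleftrightarrow> card (closer x y) = dst x y
    \<and> (\<forall>z\<in>closer x y. \<forall>z'\<in>closer x y. \<not> adj z z')
    \<and> (\<forall>w. adj y w \<longrightarrow> w \<notin> closer x y \<longrightarrow>
        dst x w = (if \<exists>z\<in>closer x y. adj z w then dst x y else dst x y + 1))"

lemma finite_closer [simp]: "finite (closer x y)"
  by (simp add: closer_def)

lemma card_closer: "x \<in> V \<Longrightarrow> y \<in> V \<Longrightarrow> card (closer x y) = c (dst x y)"
  using card_c by (simp add: closer_def)

text \<open>Count line by line: each of \<open>j\<close> lines contributes one closer vertex and
  \<open>\<sigma> - 1\<close> vertices at the same distance, each of the other \<open>m - j\<close>
  lines \<sigma> farther ones. The additive form avoids subtraction of natural numbers.\<close>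

lemma regular_at_params:
  assumes xy: "x \<in> V" "y \<in> V" "dst x y = j" and reg: "regular_at x y"
  shows "c j = j" "b j + j * \<sigma> = m * \<sigma>" "a j + j = j * \<sigma>"
proof -
  show c: "c j = j" using card_closer[OF xy(1,2)] xy(3) reg unfolding regular_at_def by simp
  let ?Z = "closer x y"
  let ?C = "{w. adj y w \<and> (w \<in> ?Z \<or> (\<exists>z\<in>?Z. adj z w))}"
    and ?B = "{w. adj y w \<and> dst x w = dst x y + 1}"
  have sub: "?Z \<subseteq> {z. adj y z}" by (auto simp: closer_def)
  have cC: "card ?C = j * \<sigma>"
    using card_cliques[OF sub] reg xy(3) unfolding regular_at_def by metis
  have cl: "dst x w \<noteq> dst x y + 1" if "w \<in> ?Z" for w using that by (simp add: closer_def)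
  have far: "dst x w = (if \<exists>z\<in>?Z. adj z w then dst x y else dst x y + 1)" if "adj y w" "w \<notin> ?Z" for w
    using reg that unfolding regular_at_def by blast
  have B: "?B = {w. adj y w} - ?C"
  proof (rule Set.set_eqI)
    fix w
    show "w \<in> ?B \<longleftrightarrow> w \<in> {w. adj y w} - ?C"
    proof (cases "adj y w \<and> w \<notin> ?Z")
      case True
      then show ?thesis using far[of w] by (cases "\<exists>z\<in>?Z. adj z w") simp_all
    next
      case False
      then show ?thesis using cl[of w] by simp
    qed
  qed
  have "card ?B + card ?C = b 0"
    unfolding B card_nb[OF xy(2), symmetric]
    by (subst card_Diff_subset) (auto intro!: le_add_diff_inverse2 card_mono)
  then show b: "b j + j * \<sigma> = m * \<sigma>" using card_b[OF xy(1,2)] xy(3) cC b_0 by simp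
  show "a j + j = j * \<sigma>" using card_nb_split[OF xy(1,2)] xy(3) b c b_0 by simp
qed

end

section \<open>The spherical representation and bounds on its deviation from the Hamming
  case\<close>

locale local_cliques_rep = local_cliques +
  fixes \<theta> \<epsilon> :: real and u :: "nat \<Rightarrow> real" and r :: "'a \<Rightarrow> 'a \<Rightarrow> real"
  assumes u_0: "u 0 = 1"
    and u_1: "real (b 0) * u 1 = \<theta>"
    and u_rec: "\<lbrakk>1 \<le> i; i \<le> d\<rbrakk> \<Longrightarrow>
      real (c i) * u (i - 1) + real (a i) * u i + real (b i) * u (i + 1) = \<theta> * u i"
    and gram: "\<lbrakk>x \<in> V; y \<in> V\<rbrakk> \<Longrightarrow> (\<Sum>z\<in>V. r x z * r y z) = u (dst x y)"
    and theta_less: "\<theta> < real (b 0)"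
    and theta_ge: "\<theta> \<ge> (1 - \<epsilon>) * real (b 1)"
    and eps_pos: "0 < \<epsilon>"
    and eps_less: "\<epsilon> < 1 / (6 * real m ^ 4 * real d)"
    and eps_k: "1 \<le> \<epsilon> * real (b 0)"
begin

definition ip :: "('a \<Rightarrow> real) \<Rightarrow> ('a \<Rightarrow> real) \<Rightarrow> real" where
  "ip f g = (\<Sum>z\<in>V. f z * g z)"

lemma ip_self: "0 \<le> ip f f"
  unfolding ip_def by (rule sum_nonneg) simp

lemma ip_comm: "ip f g = ip g f"
  by (simp add: ip_def mult.commute)

lemma ip_linear [simp]:
  "ip (\<lambda>z. f z + g z) h = ip f h + ip g h"
  "ip (\<lambda>z. f z - g z) h = ip f h - ip g h"
  "ip (\<lambda>z. t * f z) h = t * ip f h"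
  "ip h (\<lambda>z. f z + g z) = ip h f + ip h g"
  "ip h (\<lambda>z. f z - g z) = ip h f - ip h g"
  "ip h (\<lambda>z. t * f z) = t * ip h f"
  by (simp_all add: ip_def algebra_simps sum.distrib sum_subtractf sum_distrib_left)

lemma ip_sum [simp]:
  "ip (\<lambda>z. \<Sum>i\<in>I. F i z) h = (\<Sum>i\<in>I. ip (F i) h)"
  "ip h (\<lambda>z. \<Sum>i\<in>I. F i z) = (\<Sum>i\<in>I. ip h (F i))"
  unfolding ip_def sum_distrib_right sum_distrib_left by (rule sum.swap)+

lemma ip_r [simp]: "x \<in> V \<Longrightarrow> y \<in> V \<Longrightarrow> ip (r x) (r y) = u (dst x y)"
  by (simp add: ip_def gram)

abbreviation "mm \<equiv> real m"
abbreviation "ss \<equiv> real \<sigma>"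

text \<open>The three quantities measure the deviation of the representation from that of a Hamming graph
  with infinitely large lines, for which \<open>\<theta> / \<sigma> = m - 1\<close>, four-cycles are parallelograms
  (\<open>4 * quad_defect / m\<close> is the squared norm of \<open>x + y - z - z'\<close> for a four-cycle \<open>x, z, y, z'\<close>), and
  \<open>u j = (m - j) / m\<close>.\<close>
definition eta :: real where "eta = mm - 1 - \<theta> / ss"
definition quad_defect :: real where "quad_defect = mm * (u 2 - 2 * u 1 + 1)"
definition drift :: "nat \<Rightarrow> real" where "drift j = mm * u j - (mm - real j)"

lemma u_drift: "mm * u j = mm - real j + drift j"
  by (simp add: drift_def)

lemma mm2: "2 \<le> mm" using m2 by simp
lemma ss1: "1 \<le> ss" using sigma_pos by simp

lemma theta_eta: "\<theta> = ss * (mm - 1 - eta)"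
  using ss1 by (simp add: eta_def)

lemma real_b_0: "real (b 0) = mm * ss" by (simp add: b_0)
lemma real_b_1: "real (b 1) = (mm - 1) * ss"
proof -
  have "real (1 + \<sigma> + b 1) = real (m * \<sigma> + 1)" using b_1 by presburger
  then show ?thesis by (simp add: algebra_simps)
qed
lemma real_a_1: "real (a 1) = ss - 1"
  using a_1 by (metis add_diff_cancel_right' of_nat_1 of_nat_add)

lemma m_u_1: "mm * u 1 = mm - 1 - eta"
proof -
  have "ss * (mm * u 1) = ss * (mm - 1 - eta)"
    using u_1 theta_eta real_b_0 by (simp only: mult.assoc mult.commute mult.left_commute)
  then show ?thesis using ss1 by simp
qed

lemma drift_0: "drift 0 = 0" by (simp add: drift_def u_0)
lemma drift_1: "drift 1 = - eta" using m_u_1 by (simp add: drift_def)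
text \<open>The recurrence at 1 determines \<open>u 2\<close> from \<open>u 1\<close>, hence from
  \<open>eta\<close>; after substitution everything factors. Read from left to right it bounds
  \<open>eta\<close> below, and read from right to left it bounds the defect above.\<close>

lemma quad_defect_eq: "(mm - 1) * ss * quad_defect = (1 + eta) * (ss * eta - 1)"
proof -
  have "1 + (ss - 1) * u 1 + (mm - 1) * ss * u 2 = \<theta> * u 1"
    using u_rec[of 1] d2 real_b_1 real_a_1 c_1 u_0 by (simp add: numeral_2_eq_2)
  then have "mm * (1 + (ss - 1) * u 1 + (mm - 1) * ss * u 2) = mm * (\<theta> * u 1)" by simp
  then have "mm + (ss - 1) * (mm * u 1) + (mm - 1) * ss * (mm * u 2) = \<theta> * (mm * u 1)"
    by (simp only: algebra_simps)
  then have e: "(mm - 1) * ss * (mm * u 2)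
      = ss * (mm - 1 - eta) * (mm - 1 - eta) - mm - (ss - 1) * (mm - 1 - eta)"
    unfolding m_u_1 theta_eta[symmetric] by linarith
  have "quad_defect = mm * u 2 - 2 * (mm * u 1) + mm"
    unfolding quad_defect_def by (simp add: algebra_simps)
  then have q: "quad_defect = mm * u 2 + (mm - 2 * (mm - 1 - eta))"
    unfolding m_u_1 by linarith
  have "(mm - 1) * ss * quad_defect
      = (mm - 1) * ss * (mm * u 2) + (mm - 1) * ss * (mm - 2 * (mm - 1 - eta))"
    unfolding q by (rule distrib_left)
  moreover have "s * (t - 1 - x) * (t - 1 - x) - t - (s - 1) * (t - 1 - x) + (t - 1) * s * (t - 2 * (t - 1 - x))
    = (1 + x) * (s * x - 1)" for s t x :: real
    by (simp add: algebra_simps)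
  ultimately show ?thesis unfolding e by simp
qed

lemma eta_gt: "-1 < eta"
proof -
  have "\<theta> < mm * ss" using theta_less real_b_0 by simp
  then have "\<theta> / ss < mm" using ss1 by (simp add: divide_less_eq)
  then show ?thesis by (simp add: eta_def)
qed

text \<open>If two common neighbours \<open>z\<close>, \<open>z'\<close> were adjacent, then
  \<open>x\<close>, \<open>z'\<close>, \<open>y\<close> would lie in one clique of the neighbourhood
  of \<open>z\<close>, and \<open>x\<close>, \<open>y\<close> would be adjacent. So both diagonals
  of the four-cycle have length 2, and one value \<open>u 2\<close> serves for both.\<close>

lemma common_nb:
  assumes "x \<in> V" "y \<in> V" "dst x y = 2"
  shows "card {w. adj x w \<and> adj y w} = c 2"
    "\<lbrakk>adj x z; adj y z; adj x z'; adj y z'; z \<noteq> z'\<rbrakk> \<Longrightarrow> \<not> adj z z' \<and> dst z z' = 2"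
proof -
  have "{w. adj y w \<and> dst x w + 1 = dst x y} = {w. adj x w \<and> adj y w}"
    using assms dst_1 adj_V2 by auto
  then show "card {w. adj x w \<and> adj y w} = c 2" using card_c[OF assms(1,2)] assms(3) by simp
  assume a: "adj x z" "adj y z" "adj x z'" "adj y z'" "z \<noteq> z'"
  have n: "\<not> adj x y" "x \<noteq> y" using assms dst_1[OF assms(1,2)] by auto
  have "\<not> adj z z'" using clique_trans[of z x z' y] a n adj_sym by blast
  then show "\<not> adj z z' \<and> dst z z' = 2" using dst_2[of x z z'] a by blast
qed

lemma quad_defect_nonneg: "0 \<le> quad_defect"
proof -
  obtain x y where xy: "x \<in> V" "y \<in> V" "dst x y = 2" using dst_attained[OF d2] by auto
  obtain z z' where z: "adj x z" "adj y z" "adj x z'" "adj y z'" "z \<noteq> z'"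
  proof -
    have "2 \<le> card {w. adj x w \<and> adj y w}" using common_nb(1)[OF xy] c2 by simp
    then obtain T where "T \<subseteq> {w. adj x w \<and> adj y w}" "card T = 2"
      using obtain_subset_with_card_n by metis
    then show ?thesis using that by (auto simp: card_2_iff)
  qed
  have V: "z \<in> V" "z' \<in> V" using z adj_V2 by auto
  have D: "dst z z' = 2" "dst z' z = 2" "dst y x = 2" using common_nb(2)[OF xy z] dst_sym V xy by auto
  note A = z(1-4)[THEN adj_dst] z(1-4)[THEN adj_sym, THEN adj_dst]
  have "0 \<le> ip (\<lambda>t. r x t + r y t - r z t - r z' t) (\<lambda>t. r x t + r y t - r z t - r z' t)"
    by (rule ip_self)
  then have "0 \<le> u 2 - 2 * u 1 + 1" using V D A xy by (simp add: u_0)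
  then show ?thesis using mm2 by (simp add: quad_defect_def)
qed

text \<open>This is \<open>\<theta> \<le> b 1 - 1\<close>. In \<open>quad_defect_eq\<close> the
  factor \<open>1 + eta\<close> is positive because \<theta> is below the valency, so nonnegativity
  of the defect fixes the sign of the other factor.\<close>

lemma eta_ge: "1 \<le> ss * eta"
proof (rule ccontr)
  assume "\<not> 1 \<le> ss * eta"
  then have "(1 + eta) * (ss * eta - 1) < 0" using eta_gt by (intro mult_pos_neg) auto
  moreover have "0 \<le> (mm - 1) * ss * quad_defect" using quad_defect_nonneg mm2 ss1 by simp
  ultimately show False using quad_defect_eq by simp
qed

lemma eta_pos: "0 < eta" using eta_ge ss1 zero_less_mult_pos[of ss eta] by linarith

lemma eta_le: "eta \<le> \<epsilon> * (mm - 1)"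
proof -
  have "(1 - \<epsilon>) * ((mm - 1) * ss) \<le> ss * (mm - 1 - eta)" using theta_ge real_b_1 theta_eta by simp
  then have "ss * eta \<le> ss * (\<epsilon> * (mm - 1))" by (simp add: algebra_simps)
  then show ?thesis using ss1 by simp
qed

lemma eps_md: "6 * \<epsilon> * mm ^ 4 * real d < 1"
  using eps_less mm2 d2 by (simp add: field_simps)

lemma eps_m: "12 * \<epsilon> * mm ^ 4 \<le> 1"
proof -
  have "6 * \<epsilon> * mm ^ 4 * 2 \<le> 6 * \<epsilon> * mm ^ 4 * real d"
    using d2 eps_pos by (intro mult_left_mono) auto
  then show ?thesis using eps_md by linarith
qed

lemma pow_mono: "mm ^ n \<ge> 2 ^ n" using mm2 by (simp add: power_mono)

lemma eps_small: "\<epsilon> * mm \<le> 1 / 96"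
proof -
  have "8 * (\<epsilon> * mm) \<le> mm ^ 3 * (\<epsilon> * mm)"
    using pow_mono[of 3] eps_pos mm2 by (intro mult_right_mono) auto
  also have "\<dots> = \<epsilon> * mm ^ 4" by (simp add: power4_eq_xxxx power3_eq_cube)
  finally show ?thesis using eps_m by simp
qed

lemma eta_le': "eta \<le> \<epsilon> * mm"
  using eta_le eps_pos by (simp add: algebra_simps)

lemma eta_small: "eta \<le> 1 / 96" using eta_le' eps_small by linarith

text \<open>Dropping the \<open>- 1\<close> in \<open>quad_defect_eq\<close> and inserting the upper
  bound for \<open>eta\<close> gives \<open>quad_defect \<le> (1 + eta) * \<epsilon>\<close>. With
  \<open>12 * \<epsilon> * mm ^ 4 \<le> 1\<close> and \<open>eta \<le> 1 / 96\<close> the constant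
  11 is safe.\<close>

lemma quad_defect_le: "11 * mm ^ 4 * quad_defect \<le> 1"
proof -
  have "(mm - 1) * ss * quad_defect \<le> (1 + eta) * (ss * eta)"
    unfolding quad_defect_eq using eta_pos by (intro mult_left_mono) auto
  also have "\<dots> \<le> (1 + eta) * (ss * (\<epsilon> * (mm - 1)))"
    using eta_pos eta_le ss1 by (intro mult_left_mono) auto
  finally have "((mm - 1) * ss) * quad_defect \<le> ((mm - 1) * ss) * ((1 + eta) * \<epsilon>)"
    by (simp add: algebra_simps)
  then have "quad_defect \<le> (1 + eta) * \<epsilon>" using mm2 ss1 by (simp add: mult_le_cancel_left_pos)
  also have "\<dots> \<le> 97 / 96 * \<epsilon>" using eta_small eps_pos by (intro mult_right_mono) auto
  finally have "mm ^ 4 * quad_defect \<le> mm ^ 4 * (97 / 96 * \<epsilon>)" by (intro mult_left_mono) auto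
  then show ?thesis using eps_m by (simp add: algebra_simps)
qed

lemma quad_defect_small: "quad_defect \<le> 1 / 176"
proof -
  have "16 * quad_defect \<le> mm ^ 4 * quad_defect"
    using pow_mono[of 4] quad_defect_nonneg by (intro mult_right_mono) auto
  then show ?thesis using quad_defect_le by simp
qed

text \<open>Three common neighbours would give a vector \<open>3 (x + y) - 2 (z + z' + z'')\<close>, scaled by \<open>m\<close>,
  of squared norm near \<open>-12\<close>.\<close>
lemma c_2: "c 2 = 2"
proof (rule ccontr)
  assume "c 2 \<noteq> 2"
  obtain x y where xy: "x \<in> V" "y \<in> V" "dst x y = 2" using dst_attained[OF d2] by auto
  have "3 \<le> card {w. adj x w \<and> adj y w}" using common_nb(1)[OF xy] c2 \<open>c 2 \<noteq> 2\<close> by simp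
  then obtain T where "T \<subseteq> {w. adj x w \<and> adj y w}" "card T = 3"
    using obtain_subset_with_card_n by metis
  then obtain z1 z2 z3 where z: "adj x z1" "adj y z1" "adj x z2" "adj y z2" "adj x z3" "adj y z3"
    "z1 \<noteq> z2" "z1 \<noteq> z3" "z2 \<noteq> z3" by (auto simp: card_3_iff)
  have V: "z1 \<in> V" "z2 \<in> V" "z3 \<in> V" using z adj_V2 by auto
  have D: "dst z1 z2 = 2" "dst z2 z1 = 2" "dst z1 z3 = 2" "dst z3 z1 = 2" "dst z2 z3 = 2" "dst z3 z2 = 2"
    "dst y x = 2" using common_nb(2)[OF xy] z dst_sym V xy by metis+
  note A = z(1-6)[THEN adj_dst] z(1-6)[THEN adj_sym, THEN adj_dst]
  let ?f = "\<lambda>t. 3 * (r x t + r y t) - 2 * (r z1 t + r z2 t + r z3 t)"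
  have "0 \<le> ip ?f ?f" by (rule ip_self)
  then have "0 \<le> 30 + 42 * u 2 - 72 * u 1" using V D A xy by (simp add: u_0)
  then have "0 \<le> mm * (30 + 42 * u 2 - 72 * u 1)" using mm2 by simp
  also have "\<dots> = 42 * quad_defect - 12 - 12 * eta"
    using m_u_1 unfolding quad_defect_def by (simp add: algebra_simps)
  finally show False using quad_defect_small eta_pos by simp
qed

end

section \<open>Residuals in the spherical representation\<close>

text \<open>The recurrence at \<open>j\<close> with the Hamming values of the intersection numbers
  and with each \<open>m * u i\<close> written as \<open>m - i\<close> plus drift. Of the terms free
  of drift only \<open>- s * \<eta> * (m - j)\<close> and \<open>- j\<close> survive: the deviation
  of the eigenvalue and the effect of finite lines.\<close>

lemma drift_rec_rearranged:
  fixes A j s \<eta> h h' h2 m :: real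
  assumes "j * (m - j + 1 + h') + (j * s - j) * (m - j + h) + (m - j) * s * (m - j - 1 + h2)
    = s * (m - 1 - \<eta>) * (m - j + h)"
  shows "s * ((m - j) * h2) = s * ((m - j - 1 - \<eta>) * h - \<eta> * (m - j)) - j * (1 + h' - h)"
proof -
  have "s * ((m - j) * h2) - (s * ((m - j - 1 - \<eta>) * h - \<eta> * (m - j)) - j * (1 + h' - h))
    = (j * (m - j + 1 + h') + (j * s - j) * (m - j + h) + (m - j) * s * (m - j - 1 + h2))
      - s * (m - 1 - \<eta>) * (m - j + h)"
    by (simp add: algebra_simps)
  then show ?thesis using assms by simp
qed

context local_cliques_rep
begin

definition ed :: "'a \<Rightarrow> 'a \<Rightarrow> 'a \<Rightarrow> real" where
  "ed x y = (\<lambda>t. r x t - r y t)"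

lemma ip_ed:
  "\<lbrakk>x \<in> V; y \<in> V; p \<in> V; q \<in> V\<rbrakk> \<Longrightarrow>
    ip (ed x y) (ed p q) = u (dst x p) - u (dst x q) - (u (dst y p) - u (dst y q))"
  by (simp add: ed_def)

text \<open>Scaled by \<open>m\<close>, the Gram matrix of the edges at \<open>y\<close> is close to
  2 on the diagonal, 1 within a line and 0 between lines. These near-integers later separate
  adjacent, equal and nonadjacent neighbours.\<close>

lemma ip_ed_nb:
  assumes "adj y z" "adj y z'"
  shows "mm * ip (ed z y) (ed z' y) = (if z = z' then 2 + 2 * eta else if adj z z' then 1 + eta else quad_defect)"
proof -
  have V: "y \<in> V" "z \<in> V" "z' \<in> V" using assms adj_V adj_V2 by auto
  have D: "dst z y = 1" "dst y z' = 1" using assms adj_dst adj_sym by auto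
  have e: "ip (ed z y) (ed z' y) = u (dst z z') - 2 * u 1 + 1"
    using ip_ed[OF V(2,1,3,1)] D V by (simp add: u_0)
  consider "z = z'" | "z \<noteq> z'" "adj z z'" | "z \<noteq> z'" "\<not> adj z z'" by blast
  then show ?thesis
  proof cases
    case 1
    then have e1: "ip (ed z y) (ed z' y) = 2 - 2 * u 1" using e V by (simp add: u_0)
    have "mm * ip (ed z y) (ed z' y) = 2 * mm - 2 * (mm * u 1)" unfolding e1 by (simp add: algebra_simps)
    then show ?thesis using 1 unfolding m_u_1 by simp
  next
    case 2
    then have e1: "ip (ed z y) (ed z' y) = 1 - u 1" using e adj_dst[OF 2(2)] by simp
    have "mm * ip (ed z y) (ed z' y) = mm - mm * u 1" unfolding e1 by (simp add: algebra_simps)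
    then show ?thesis using 2 unfolding m_u_1 by simp
  next
    case 3
    then show ?thesis using e dst_2[OF assms 3] by (simp add: quad_defect_def)
  qed
qed

lemma ip_ed_base:
  assumes "x \<in> V" "adj y w"
  shows "mm * ip (ed x y) (ed w y) = 1 + real (dst x y) - real (dst x w) + drift (dst x w) - drift (dst x y) + eta"
proof -
  have V: "y \<in> V" "w \<in> V" using assms adj_V adj_V2 by auto
  have e: "ip (ed x y) (ed w y) = u (dst x w) - u (dst x y) - u 1 + 1"
    using ip_ed[OF assms(1) V(1,2,1)] adj_dst[OF assms(2)] V by (simp add: u_0)
  have "mm * ip (ed x y) (ed w y) = mm * u (dst x w) - mm * u (dst x y) - mm * u 1 + mm"
    unfolding e by (simp add: algebra_simps)
  then show ?thesis unfolding u_drift[of "dst x w"] u_drift[of "dst x y"] m_u_1 by simp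
qed

lemma ip_ed_self:
  assumes "x \<in> V" "y \<in> V"
  shows "mm * ip (ed x y) (ed x y) = 2 * real (dst x y) - 2 * drift (dst x y)"
proof -
  have e: "ip (ed x y) (ed x y) = 2 - 2 * u (dst x y)"
    using ip_ed[OF assms assms] dst_sym[OF assms] assms by (simp add: u_0)
  have "mm * ip (ed x y) (ed x y) = 2 * mm - 2 * (mm * u (dst x y))"
    unfolding e by (simp add: algebra_simps)
  then show ?thesis unfolding u_drift by simp
qed

definition drift_bounded :: "nat \<Rightarrow> bool" where
  "drift_bounded j \<longleftrightarrow> \<bar>drift j\<bar> \<le> 3 / 2 * (real j * (\<epsilon> * mm))"

text \<open>The factor \<open>d\<close> in the bound on \<epsilon> is spent here, on the linear
  growth of the drift; the factor \<open>mm ^ 3\<close> remains for sums over the lines through a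
  vertex.\<close>

lemma eps_m_mult:
  assumes "j \<le> d" shows "6 * mm ^ 3 * (real j * (\<epsilon> * mm)) \<le> 1"
proof -
  have "6 * \<epsilon> * mm ^ 4 * real j \<le> 6 * \<epsilon> * mm ^ 4 * real d"
    using assms eps_pos by (intro mult_left_mono) auto
  moreover have "6 * mm ^ 3 * (real j * (\<epsilon> * mm)) = 6 * \<epsilon> * mm ^ 4 * real j"
    by (simp add: power4_eq_xxxx power3_eq_cube)
  ultimately show ?thesis using eps_md by linarith
qed

lemma eps_m_mult_small:
  assumes "j \<le> d" shows "real j * (\<epsilon> * mm) \<le> 1 / 48"
proof -
  have "8 * (real j * (\<epsilon> * mm)) \<le> mm ^ 3 * (real j * (\<epsilon> * mm))"
    using pow_mono[of 3] eps_pos by (intro mult_right_mono) auto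
  then show ?thesis using eps_m_mult[OF assms] by linarith
qed

lemma drift_small:
  assumes "j \<le> d" "drift_bounded j"
  shows "\<bar>drift j\<bar> \<le> 1 / 32" "mm * \<bar>drift j\<bar> \<le> 1 / 16"
proof -
  have b: "\<bar>drift j\<bar> \<le> 3 / 2 * (real j * (\<epsilon> * mm))" using assms(2) by (simp add: drift_bounded_def)
  then show "\<bar>drift j\<bar> \<le> 1 / 32" using eps_m_mult_small[OF assms(1)] by linarith
  have "4 * (mm * \<bar>drift j\<bar>) \<le> mm ^ 2 * (mm * \<bar>drift j\<bar>)"
    using pow_mono[of 2] by (intro mult_right_mono) auto
  also have "\<dots> = mm ^ 3 * \<bar>drift j\<bar>" by (simp add: power3_eq_cube power2_eq_square)
  also have "\<dots> \<le> mm ^ 3 * (3 / 2 * (real j * (\<epsilon> * mm)))" using b by (intro mult_left_mono) auto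
  finally show "mm * \<bar>drift j\<bar> \<le> 1 / 16" using eps_m_mult[OF assms(1)] by linarith
qed

lemma drift_bounded_Suc:
  assumes j: "1 \<le> j" "j < d" and par: "c j = j" "b j + j * \<sigma> = m * \<sigma>" "a j + j = j * \<sigma>"
    and bd: "drift_bounded j" "drift_bounded (j - 1)"
  shows "drift_bounded (j + 1)"
proof -
  \<comment> \<open>Below the diameter \<open>b j\<close> is positive, so some line through the
    vertex contains no closer vertex; this supplies \<open>M \<ge> 1\<close> in
    \<open>drift_step\<close>.\<close>
  have jm: "j < m" using par(2) b_pos[OF j(2)]
    by (metis add_less_cancel_right add.left_neutral mult_less_cancel2)
  have ra: "real (a j) = real j * ss - real j"
    using par(3) by (metis add_diff_cancel_right' of_nat_add of_nat_mult)
  have rb: "real (b j) = (mm - real j) * ss"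
    using par(2) by (metis add_diff_cancel_right' left_diff_distrib of_nat_add of_nat_mult)
  define h h' h2 where "h = drift j" and "h' = drift (j - 1)" and "h2 = drift (j + 1)"
  have U: "mm * u j = mm - real j + h" "mm * u (j - 1) = mm - real j + 1 + h'"
    "mm * u (j + 1) = mm - real j - 1 + h2"
    using j by (simp_all add: u_drift h_def h'_def h2_def of_nat_diff)
  have "mm * (real j * u (j - 1) + real (a j) * u j + real (b j) * u (j + 1)) = mm * (\<theta> * u j)"
    using u_rec[of j] j par(1) by simp
  then have E: "real j * (mm * u (j - 1)) + real (a j) * (mm * u j) + real (b j) * (mm * u (j + 1)) = \<theta> * (mm * u j)"
    by (simp only: distrib_left mult.left_commute)
  note E = E[unfolded U ra rb, THEN trans, OF arg_cong[OF theta_eta, of "\<lambda>t. t * (mm - real j + h)"]]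
  have "ss * ((mm - real j) * h2) = ss * ((mm - real j - 1 - eta) * h - eta * (mm - real j)) - real j * (1 + h' - h)"
    by (rule drift_rec_rearranged[OF E])
  moreover have "ss * ((mm - real j - 1 - eta) * h - eta * (mm - real j) - real j / ss * (1 + h' - h))
    = ss * ((mm - real j - 1 - eta) * h - eta * (mm - real j)) - real j * (1 + h' - h)"
    using ss1 by (simp add: right_diff_distrib)
  ultimately have "ss * ((mm - real j) * h2)
    = ss * ((mm - real j - 1 - eta) * h - eta * (mm - real j) - real j / ss * (1 + h' - h))" by (simp only:)
  then have rec: "(mm - real j) * h2 = (mm - real j - 1 - eta) * h - eta * (mm - real j) - real j / ss * (1 + h' - h)"
    by (rule mult_left_cancel[THEN iffD1, rotated]) (use ss1 in simp)
  \<comment> \<open>Since the valency is \<open>mm * ss\<close>, its lower bound turns the error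
    from finite lines, of order \<open>1 / ss\<close>, into one of order
    \<open>\<epsilon> * mm\<close>.\<close>
  have "1 \<le> ss * (\<epsilon> * mm)" using eps_k real_b_0 by (simp add: algebra_simps)
  then have s: "1 / ss \<le> \<epsilon> * mm" using ss1 by (simp add: field_simps)
  have "\<bar>h2\<bar> \<le> 3 / 2 * ((real j + 1) * (\<epsilon> * mm))"
    by (rule drift_step[OF _ _ _ eta_le' _ s _ _ _ rec])
      (use jm j eta_pos ss1 eps_m_mult_small[of j] bd in \<open>auto simp: drift_bounded_def h_def h'_def of_nat_diff\<close>)
  then show ?thesis by (simp add: drift_bounded_def h2_def add.commute)
qed

lemma nonadjacent_card_le:
  assumes "y \<in> V" "Z \<subseteq> {z. adj y z}" "\<And>z z'. z \<in> Z \<Longrightarrow> z' \<in> Z \<Longrightarrow> \<not> adj z z'"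
  shows "card Z \<le> m"
proof -
  have "card Z * \<sigma> = card {w. adj y w \<and> (w \<in> Z \<or> (\<exists>z\<in>Z. adj z w))}"
    using card_cliques[OF assms(2,3)] by simp
  also have "\<dots> \<le> card {w. adj y w}" by (rule card_mono) auto
  finally show ?thesis using card_nb[OF assms(1)] b_0 sigma_pos by simp
qed

lemma quad_defect_mult:
  assumes "real j \<le> mm" shows "real j * quad_defect \<le> 1 / 88" "real j * (real j - 1) * quad_defect \<le> 1 / 44"
proof -
  have q: "0 \<le> quad_defect" by (rule quad_defect_nonneg)
  have "real j * quad_defect \<le> mm * quad_defect" using assms q by (rule mult_right_mono)
  moreover have "8 * (mm * quad_defect) \<le> mm ^ 3 * (mm * quad_defect)"
    using pow_mono[of 3] q by (intro mult_right_mono) auto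
  moreover have "mm ^ 3 * (mm * quad_defect) = mm ^ 4 * quad_defect"
    by (simp add: power4_eq_xxxx power3_eq_cube)
  ultimately show "real j * quad_defect \<le> 1 / 88" using quad_defect_le by linarith
  have "real j * (real j - 1) * quad_defect \<le> real j * real j * quad_defect"
    using q by (intro mult_right_mono mult_left_mono) auto
  also have "\<dots> \<le> mm * mm * quad_defect" using assms q by (intro mult_right_mono mult_mono) auto
  finally have "real j * (real j - 1) * quad_defect \<le> mm * mm * quad_defect" .
  moreover have "4 * (mm * mm * quad_defect) \<le> mm ^ 2 * (mm * mm * quad_defect)"
    using pow_mono[of 2] q by (intro mult_right_mono) auto
  moreover have "mm ^ 2 * (mm * mm * quad_defect) = mm ^ 4 * quad_defect"
    by (simp add: power4_eq_xxxx power2_eq_square)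
  ultimately show "real j * (real j - 1) * quad_defect \<le> 1 / 44" using quad_defect_le by linarith
qed

lemma ip_residual:
  "ip (\<lambda>t. (f t - g t) - s * h t) (\<lambda>t. (f t - g t) - s * h t)
    = ip f f - 2 * ip f g + ip g g - 2 * s * ip f h + 2 * s * ip g h + s\<^sup>2 * ip h h"
  by (simp add: ip_comm[of g f] ip_comm[of h f] ip_comm[of h g] power2_eq_square algebra_simps)

text \<open>In the Hamming graph \<open>ed x y\<close> is nearly the sum of the \<open>ed z y\<close> over the neighbours \<open>z\<close> of
  \<open>y\<close> that are closer to \<open>x\<close>. The residual is so short that its inner product with any edge at \<open>y\<close>,
  which would be an integer multiple of \<open>1 / m\<close> without drift, is negligible.\<close>
lemma residual_bound:
  assumes xy: "x \<in> V" "y \<in> V" "dst x y = j" "1 \<le> j"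
    and bd: "drift_bounded j" "drift_bounded (j - 1)"
    and Z: "Z \<subseteq> closer x y" "card Z = j" "\<And>z z'. z \<in> Z \<Longrightarrow> z' \<in> Z \<Longrightarrow> \<not> adj z z'"
    and w: "adj y w"
  shows "mm * ip (ed x y) (ed w y) - (\<Sum>z\<in>Z. mm * ip (ed z y) (ed w y)) < 9 / 10"
proof -
  have jd: "j \<le> d" using dst_le xy by blast
  have finZ: "finite Z" using Z(1) finite_closer by (rule finite_subset)
  have nb: "adj y z" if "z \<in> Z" for z using Z(1) that by (auto simp: closer_def)
  have dz: "dst x z = j - 1" if "z \<in> Z" for z using Z(1) that xy by (auto simp: closer_def)
  have "card Z \<le> m" using nonadjacent_card_le[OF xy(2)] nb Z(3) by blast
  then have jm: "real j \<le> mm" using Z(2) by simp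
  let ?q = quad_defect and ?h = "drift j" and ?h' = "drift (j - 1)"
  have A2: "mm * ip (ed x y) (ed z y) = 2 + ?h' - ?h + eta" if "z \<in> Z" for z
    using ip_ed_base[OF xy(1) nb[OF that]] dz[OF that] xy by (simp add: of_nat_diff)
  have A3: "mm * ip (ed z y) (ed z' y) = ?q + (if z = z' then 2 + 2 * eta - ?q else 0)"
    if "z \<in> Z" "z' \<in> Z" for z z'
    using ip_ed_nb[OF nb[OF that(1)] nb[OF that(2)]] Z(3)[OF that] by simp
  have S2: "(\<Sum>z\<in>Z. mm * ip (ed x y) (ed z y)) = real j * (2 + ?h' - ?h + eta)"
    using A2 Z(2) by simp
  have S3: "(\<Sum>z\<in>Z. \<Sum>z'\<in>Z. mm * ip (ed z y) (ed z' y)) = real j * (real j * ?q + (2 + 2 * eta - ?q))"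
  proof -
    have "(\<Sum>z\<in>Z. \<Sum>z'\<in>Z. mm * ip (ed z y) (ed z' y)) =
      (\<Sum>z\<in>Z. \<Sum>z'\<in>Z. ?q + (if z = z' then 2 + 2 * eta - ?q else 0))"
      by (intro sum.cong refl A3)
    then show ?thesis using finZ Z(2) by (simp add: sum.distrib)
  qed
  \<comment> \<open>Half of the edge is subtracted from the residual. Nonnegativity of the norm then
    bounds the scaled inner product by the scaled squared norm of the residual plus
    \<open>1 / 2 + eta / 2\<close>. That squared norm consists of drift and defect terms only, at
    most about 0.34, so the total stays below 9/10.\<close>
  let ?f = "\<lambda>t. (ed x y t - (\<Sum>z\<in>Z. ed z y t)) - 1 / 2 * ed w y t"
  have ipf: "ip ?f ?f = ip (ed x y) (ed x y) - 2 * (\<Sum>z\<in>Z. ip (ed x y) (ed z y))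
    + (\<Sum>z\<in>Z. \<Sum>z'\<in>Z. ip (ed z y) (ed z' y))
    - ip (ed x y) (ed w y) + (\<Sum>z\<in>Z. ip (ed z y) (ed w y)) + 1 / 4 * ip (ed w y) (ed w y)"
    unfolding ip_residual[of "ed x y" "\<lambda>t. \<Sum>z\<in>Z. ed z y t" "1 / 2" "ed w y"]
    by (simp add: power2_eq_square)
  have "mm * ip ?f ?f = mm * ip (ed x y) (ed x y) - 2 * (\<Sum>z\<in>Z. mm * ip (ed x y) (ed z y))
    + (\<Sum>z\<in>Z. \<Sum>z'\<in>Z. mm * ip (ed z y) (ed z' y))
    - mm * ip (ed x y) (ed w y) + (\<Sum>z\<in>Z. mm * ip (ed z y) (ed w y)) + 1 / 4 * (mm * ip (ed w y) (ed w y))"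
    unfolding ipf sum_distrib_left[symmetric] by (simp add: algebra_simps)
  also have "mm * ip (ed w y) (ed w y) = 2 + 2 * eta" using ip_ed_nb[OF w w] by simp
  also have "mm * ip (ed x y) (ed x y) = 2 * real j - 2 * ?h" using ip_ed_self[OF xy(1,2)] xy(3) by simp
  finally have "mm * ip ?f ?f = 2 * (real j * ?h) - 2 * ?h - 2 * (real j * ?h') + real j * (real j - 1) * ?q
    - mm * ip (ed x y) (ed w y) + (\<Sum>z\<in>Z. mm * ip (ed z y) (ed w y)) + 1 / 2 + eta / 2"
    unfolding S2 S3 by (simp add: algebra_simps)
  moreover have "0 \<le> mm * ip ?f ?f" using ip_self[of ?f] by simp
  moreover have "\<bar>real j * ?h\<bar> \<le> 1 / 16" "\<bar>real j * ?h'\<bar> \<le> 1 / 16"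
  proof -
    have "real j * \<bar>?h\<bar> \<le> mm * \<bar>?h\<bar>" "real j * \<bar>?h'\<bar> \<le> mm * \<bar>?h'\<bar>"
      using jm by (intro mult_right_mono; simp)+
    moreover have "j - 1 \<le> d" using jd by simp
    note drift_small(2)[OF jd bd(1)] drift_small(2)[OF this bd(2)]
    moreover have "\<bar>real j * ?h\<bar> = real j * \<bar>?h\<bar>" "\<bar>real j * ?h'\<bar> = real j * \<bar>?h'\<bar>"
      by (simp_all add: abs_mult)
    ultimately show "\<bar>real j * ?h\<bar> \<le> 1 / 16" "\<bar>real j * ?h'\<bar> \<le> 1 / 16" by linarith+
  qed
  moreover have "\<bar>?h\<bar> \<le> 1 / 32" using drift_small(1)[OF jd bd(1)] .
  ultimately show ?thesis using quad_defect_mult(2)[OF jm] eta_small by linarith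
qed

text \<open>If \<open>w\<close> in a line missed by \<open>Z\<close> were not farther from
  \<open>x\<close>, its scaled inner product would be at least 1, against a sum of \<open>j\<close>
  copies of the tiny \<open>quad_defect\<close>. If \<open>w\<close> in the line of some
  \<open>z\<close> were closer as well, it would be about 2 against about 1. Both excesses exceed
  the 9/10 of \<open>residual_bound\<close>. Hence \<open>Z\<close> is already all of
  \<open>closer x y\<close>.\<close>

lemma regular_atI:
  assumes xy: "x \<in> V" "y \<in> V" "dst x y = j" "1 \<le> j"
    and bd: "drift_bounded j" "drift_bounded (j - 1)"
    and Z: "Z \<subseteq> closer x y" "card Z = j" "\<And>z z'. z \<in> Z \<Longrightarrow> z' \<in> Z \<Longrightarrow> \<not> adj z z'"
  shows "regular_at x y"
proof -
  have jd: "j \<le> d" using dst_le xy by blast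
  have finZ: "finite Z" using Z(1) finite_closer by (rule finite_subset)
  have nb: "adj y z" if "z \<in> Z" for z using Z(1) that by (auto simp: closer_def)
  have dz: "dst x z = j - 1" if "z \<in> Z" for z using Z(1) that xy by (auto simp: closer_def)
  have "card Z \<le> m" using nonadjacent_card_le[OF xy(2)] nb Z(3) by blast
  then have jm: "real j \<le> mm" using Z(2) by simp
  have "j - 1 \<le> d" using jd by simp
  note small = drift_small(1)[OF jd bd(1)] drift_small(1)[OF this bd(2)] quad_defect_mult(1)[OF jm]
  have off: "dst x w = j + 1" if w: "adj y w" "w \<notin> Z" "\<And>z. z \<in> Z \<Longrightarrow> \<not> adj z w" for w
  proof (rule ccontr)
    assume "dst x w \<noteq> j + 1"
    moreover have "dst x w \<le> j + 1" "j \<le> dst x w + 1"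
      using dst_step[OF xy(1) w(1)] dst_step'[OF xy(1) w(1)] xy(3) by auto
    ultimately have "dst x w = j \<or> dst x w = j - 1" using xy(4) by linarith
    then have "mm * ip (ed x y) (ed w y) \<ge> 1"
    proof
      assume "dst x w = j"
      then show ?thesis using ip_ed_base[OF xy(1) w(1)] xy(3) eta_pos by simp
    next
      assume e: "dst x w = j - 1"
      then have "mm * ip (ed x y) (ed w y) = 2 + drift (j - 1) - drift j + eta"
        using ip_ed_base[OF xy(1) w(1)] xy(3,4) by (simp add: of_nat_diff)
      then show ?thesis using small(1,2) eta_pos by linarith
    qed
    moreover have "(\<Sum>z\<in>Z. mm * ip (ed z y) (ed w y)) = (\<Sum>z\<in>Z. quad_defect)"
    proof (rule sum.cong[OF refl])
      fix z assume "z \<in> Z"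
      then show "mm * ip (ed z y) (ed w y) = quad_defect"
        using ip_ed_nb[OF nb w(1)] w(2,3) by auto
    qed
    ultimately show False
      using residual_bound[OF xy bd Z w(1)] small(3) Z(2) by simp
  qed
  have on: "dst x w = j" if w: "adj y w" "z \<in> Z" "adj z w" for w z
  proof (rule ccontr)
    assume "dst x w \<noteq> j"
    moreover have "dst x w \<le> j" using dst_step[OF xy(1) w(3)] dz[OF w(2)] xy(4) by simp
    moreover have "j \<le> dst x w + 1" using dst_step'[OF xy(1) w(1)] xy(3) by simp
    ultimately have "dst x w = j - 1" using xy(4) by linarith
    then have "mm * ip (ed x y) (ed w y) = 2 + drift (j - 1) - drift j + eta"
      using ip_ed_base[OF xy(1) w(1)] xy(3,4) by (simp add: of_nat_diff)
    then have "mm * ip (ed x y) (ed w y) \<ge> 2 - 1 / 16 + eta" using small(1,2) by linarith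
    moreover have "(\<Sum>z\<in>Z. mm * ip (ed z y) (ed w y)) \<le> 1 + eta + real j * quad_defect"
    proof -
      have "mm * ip (ed z' y) (ed w y) = quad_defect" if z': "z' \<in> Z" "z' \<noteq> z" for z'
      proof -
        have "z' \<noteq> w" using Z(3)[OF w(2) z'(1)] w(3) by blast
        moreover have "\<not> adj z' w"
          using clique_trans[OF nb[OF w(2)] w(1) nb[OF z'(1)] w(3)] adj_sym Z(3)[OF w(2) z'(1)] z'(2) by blast
        ultimately show ?thesis using ip_ed_nb[OF nb[OF z'(1)] w(1)] by simp
      qed
      then have "(\<Sum>z\<in>Z - {z}. mm * ip (ed z y) (ed w y)) = real (card (Z - {z})) * quad_defect" by simp
      also have "\<dots> \<le> real j * quad_defect"
        using finZ w(2) Z(2) quad_defect_nonneg by (intro mult_right_mono) auto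
      finally have "(\<Sum>z\<in>Z - {z}. mm * ip (ed z y) (ed w y)) \<le> real j * quad_defect" .
      moreover have "(\<Sum>z\<in>Z. mm * ip (ed z y) (ed w y))
        = mm * ip (ed z y) (ed w y) + (\<Sum>z\<in>Z - {z}. mm * ip (ed z y) (ed w y))"
        by (rule sum.remove[OF finZ w(2)])
      moreover have "mm * ip (ed z y) (ed w y) = 1 + eta"
        using ip_ed_nb[OF nb[OF w(2)] w(1)] w(3) adj_neq[OF w(3)] by simp
      ultimately show ?thesis by linarith
    qed
    ultimately show False using residual_bound[OF xy bd Z w(1)] small(3) by linarith
  qed
  have "closer x y = Z"
  proof
    show "closer x y \<subseteq> Z"
    proof
      fix w assume "w \<in> closer x y"
      then have w: "adj y w" "dst x w + 1 = j" using xy(3) by (auto simp: closer_def)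
      show "w \<in> Z"
      proof (rule ccontr)
        assume "w \<notin> Z"
        then show False using off[OF w(1)] on[OF w(1)] w(2) by fastforce
      qed
    qed
  qed (rule Z(1))
  then show ?thesis unfolding regular_at_def using Z(2,3) off on xy(3) by auto
qed

end

section \<open>The intersection numbers\<close>

context local_cliques_rep
begin

section \<open>Transport along an edge by four-cycles, and the induction on distance\<close>

lemma ip_amgm: "2 * s * ip f g \<le> s\<^sup>2 * ip f f + ip g g"
proof -
  have "0 \<le> ip (\<lambda>t. s * f t - g t) (\<lambda>t. s * f t - g t)" by (rule ip_self)
  then show ?thesis by (simp add: ip_comm[of g f] power2_eq_square algebra_simps)
qed

lemma parallelogram_defect:
  assumes "adj x y" "adj x w" "adj y g" "adj w g" "dst w y = 2" "dst x g = 2"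
  shows "mm * ip (\<lambda>t. ed g y t - ed w x t) (\<lambda>t. ed g y t - ed w x t) = 4 * quad_defect"
proof -
  have V: "x \<in> V" "y \<in> V" "w \<in> V" "g \<in> V" using assms adj_V adj_V2 by blast+
  note A = assms(1-4)[THEN adj_dst] assms(1-4)[THEN adj_sym, THEN adj_dst]
  have D: "dst y w = 2" "dst g x = 2" using assms(5,6) dst_sym V by auto
  have "ip (\<lambda>t. ed g y t - ed w x t) (\<lambda>t. ed g y t - ed w x t) = 4 * (u 2 - 2 * u 1 + 1)"
    using V A D assms(5,6) by (simp add: ed_def u_0)
  then show ?thesis by (simp add: quad_defect_def)
qed

text \<open>Opposite edges of a four-cycle are almost equal vectors, so the inner product of the
  edges to \<open>g\<close> and \<open>g'\<close> at \<open>y\<close> is close to that of the edges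
  to \<open>w\<close> and \<open>w'\<close> at \<open>x\<close>, which is close to 0. Adjacency or
  equality of \<open>g\<close>, \<open>g'\<close> would make it at least 1.\<close>

lemma transport_nonadjacent:
  assumes xy: "adj x y"
    and w: "adj x w" "adj y g" "adj w g" "dst w y = 2" "dst x g = 2"
    and w': "adj x w'" "adj y g'" "adj w' g'" "dst w' y = 2" "dst x g' = 2"
    and n: "\<not> adj w w'" "w \<noteq> w'"
  shows "\<not> adj g g'" "g \<noteq> g'"
proof -
  let ?P = "\<lambda>t. ed g y t - ed w x t" and ?Q = "\<lambda>t. ed g' y t - ed w' x t"
  \<comment> \<open>The weight 8 balances the two error sources: each correction is at most
    \<open>16 * quad_defect\<close> from the four-cycle plus about 1/8 from the edge, so together
    they stay well below 1.\<close>
  have "2 * 8 * ip ?P (ed g' y) \<le> 8\<^sup>2 * ip ?P ?P + ip (ed g' y) (ed g' y)"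
    "2 * 8 * ip ?Q (ed w x) \<le> 8\<^sup>2 * ip ?Q ?Q + ip (ed w x) (ed w x)"
    by (rule ip_amgm)+
  then have "mm * (16 * ip ?P (ed g' y)) \<le> mm * (64 * ip ?P ?P + ip (ed g' y) (ed g' y))"
    "mm * (16 * ip ?Q (ed w x)) \<le> mm * (64 * ip ?Q ?Q + ip (ed w x) (ed w x))"
    by (intro mult_left_mono; simp)+
  then have b: "16 * (mm * ip ?P (ed g' y)) \<le> 64 * (mm * ip ?P ?P) + mm * ip (ed g' y) (ed g' y)"
    "16 * (mm * ip ?Q (ed w x)) \<le> 64 * (mm * ip ?Q ?Q) + mm * ip (ed w x) (ed w x)"
    by (simp_all only: distrib_left mult.left_commute)
  have e: "mm * ip (ed g y) (ed g' y) = mm * ip (ed w x) (ed w' x) + mm * ip ?P (ed g' y) + mm * ip ?Q (ed w x)"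
    by (simp add: ip_comm[of "ed w' x" "ed w x"] ip_comm[of "ed g' y" "ed w x"] algebra_simps)
  have "mm * ip (ed g y) (ed g' y) < 1"
    using b e quad_defect_small eta_small
    unfolding parallelogram_defect[OF xy w] parallelogram_defect[OF xy w']
    using ip_ed_nb[OF w(1) w'(1)] ip_ed_nb[OF w'(2) w'(2)] ip_ed_nb[OF w(1) w(1)] n by simp
  then show "\<not> adj g g'" "g \<noteq> g'"
    using ip_ed_nb[OF w(2) w'(2)] eta_pos by (auto split: if_splits)
qed

lemma fourth_vertex:
  assumes "adj x w" "adj x y" "dst w y = 2"
  obtains g where "adj y g" "adj w g" "g \<noteq> x" "dst x g = 2"
proof -
  have V: "w \<in> V" "y \<in> V" using assms adj_V2 by auto
  have c: "card {g. adj w g \<and> adj y g} = 2" using common_nb(1)[OF V assms(3)] c_2 by simp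
  obtain g where "g \<in> {g. adj w g \<and> adj y g}" "g \<noteq> x"
    by (metis c card_2_iff')
  then show ?thesis
    using that[of g] common_nb(2)[OF V assms(3), of x g] assms adj_sym by blast
qed

text \<open>For each \<open>w\<close> adjacent to \<open>x'\<close> and closer to \<open>x\<close>,
  the path \<open>w\<close>, \<open>x'\<close>, \<open>y\<close> completes to a four-cycle, whose
  fourth vertex is a neighbour of \<open>y\<close> at distance \<open>j\<close> from
  \<open>x\<close>. These \<open>j\<close> vertices and \<open>x'\<close> form \<open>Z\<close>;
  different lines at \<open>x'\<close> are carried to different lines at \<open>y\<close>.\<close>

lemma closer_extend:
  assumes xy: "x \<in> V" "y \<in> V" "dst x y = Suc j" and x': "adj y x'" "dst x x' = j"
    and reg: "regular_at x x'"
  obtains Z where "Z \<subseteq> closer x y" "card Z = Suc j" "\<And>z z'. z \<in> Z \<Longrightarrow> z' \<in> Z \<Longrightarrow> \<not> adj z z'"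
proof -
  let ?Z = "closer x x'"
  have xy': "adj x' y" using x' adj_sym by blast
  have cl: "adj x' w" "dst x w + 1 = j" if "w \<in> ?Z" for w using that x' by (auto simp: closer_def)
  have d2': "dst w y = 2" if "w \<in> ?Z" for w
  proof (rule dst_2[OF cl(1)[OF that] xy'])
    show "w \<noteq> y" using cl(2)[OF that] xy(3) by auto
    show "\<not> adj w y" using dst_step[OF xy(1), of w y] cl(2)[OF that] xy(3) by auto
  qed
  have "\<exists>g. adj y g \<and> adj w g \<and> g \<noteq> x' \<and> dst x' g = 2" if "w \<in> ?Z" for w
    using fourth_vertex[OF cl(1)[OF that] xy' d2'[OF that]] by metis
  then obtain g where g: "\<And>w. w \<in> ?Z \<Longrightarrow> adj y (g w) \<and> adj w (g w) \<and> g w \<noteq> x' \<and> dst x' (g w) = 2"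
    by metis
  have non: "\<not> adj w w'" if "w \<in> ?Z" "w' \<in> ?Z" for w w'
    using reg that unfolding regular_at_def by blast
  have tr: "\<not> adj (g w) (g w') \<and> g w \<noteq> g w'" if "w \<in> ?Z" "w' \<in> ?Z" "w \<noteq> w'" for w w'
    using transport_nonadjacent[OF xy' cl(1)[OF that(1)] _ _ d2'[OF that(1)] _
        cl(1)[OF that(2)] _ _ d2'[OF that(2)] _ non[OF that(1,2)] that(3)] g[OF that(1)] g[OF that(2)]
    by blast
  have notx': "\<not> adj x' (g w)" if "w \<in> ?Z" for w
    using g[OF that] adj_dst by fastforce
  let ?W = "insert x' (g ` ?Z)"
  show ?thesis
  proof (rule that[of ?W])
    show "?W \<subseteq> closer x y"
    proof
      fix v assume "v \<in> ?W"
      then consider "v = x'" | w where "w \<in> ?Z" "v = g w" by blast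
      then show "v \<in> closer x y"
      proof cases
        case 1
        then show ?thesis using x' xy(3) by (simp add: closer_def)
      next
        case 2
        have "dst x v \<le> j" using dst_step[OF xy(1), of w v] cl(2)[OF 2(1)] g[OF 2(1)] 2(2) by auto
        moreover have "Suc j \<le> dst x v + 1"
          using dst_step'[OF xy(1), of y v] xy(3) g[OF 2(1)] 2(2) by auto
        ultimately show ?thesis using g[OF 2(1)] 2(2) xy(3) by (simp add: closer_def)
      qed
    qed
    have "inj_on g ?Z" using tr by (meson inj_onI)
    then have "card (g ` ?Z) = j" using reg x'(2) unfolding regular_at_def by (simp add: card_image)
    moreover have "x' \<notin> g ` ?Z" using g by blast
    ultimately show "card ?W = Suc j" by simp
    fix z z' assume "z \<in> ?W" "z' \<in> ?W"
    then consider "z = x'" "z' = x'" | w where "w \<in> ?Z" "z = x'" "z' = g w"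
      | w where "w \<in> ?Z" "z = g w" "z' = x'" | w w' where "w \<in> ?Z" "w' \<in> ?Z" "z = g w" "z' = g w'"
      by blast
    then show "\<not> adj z z'"
    proof cases
      case 1
      then show ?thesis using adj_irrefl by simp
    next
      case 2
      then show ?thesis using notx' by simp
    next
      case 3
      then show ?thesis using notx' adj_sym by blast
    next
      case 4
      then show ?thesis using tr adj_irrefl by (cases "w = w'") auto
    qed
  qed
qed

text \<open>Regularity at distance \<open>j\<close> gives the intersection numbers there, hence the
  drift bound at \<open>j + 1\<close> by the recurrence; the drift bounds at \<open>j\<close> and
  \<open>j + 1\<close> together give regularity at \<open>j + 1\<close> through the residual.
  Earlier drift bounds are kept because the recurrence reaches back two steps.\<close>

lemma drift_regular:
  assumes "j \<le> d"
  shows "(\<forall>i\<le>j. drift_bounded i) \<and> (\<forall>x\<in>V. \<forall>y\<in>V. dst x y = j \<longrightarrow> regular_at x y)"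
  using assms
proof (induction j)
  case 0
  have "regular_at x x" if "x \<in> V" for x
    unfolding regular_at_def using that by (auto simp: closer_def adj_dst)
  then show ?case using drift_0 dst_0 by (auto simp: drift_bounded_def)
next
  case (Suc j)
  then have IH: "\<forall>i\<le>j. drift_bounded i" and reg: "\<forall>x\<in>V. \<forall>y\<in>V. dst x y = j \<longrightarrow> regular_at x y"
    by auto
  have new: "drift_bounded (Suc j)"
  proof (cases "j = 0")
    case True
    then show ?thesis using drift_1 eta_le' eta_pos eps_pos by (simp add: drift_bounded_def)
  next
    case False
    obtain x y where xy: "x \<in> V" "y \<in> V" "dst x y = j" using dst_attained[of j] Suc.prems by auto
    have "drift_bounded (j + 1)"
      by (rule drift_bounded_Suc[OF _ _ regular_at_params[OF xy]]) (use False Suc.prems IH reg xy in auto)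
    then show ?thesis by simp
  qed
  have "regular_at x y" if xy: "x \<in> V" "y \<in> V" "dst x y = Suc j" for x y
  proof -
    obtain x' where x': "adj x' y" "dst x x' = j" using dst_pred[OF xy] by auto
    then have "regular_at x x'" using reg xy adj_V by blast
    then obtain Z where "Z \<subseteq> closer x y" "card Z = Suc j" "\<And>z z'. z \<in> Z \<Longrightarrow> z' \<in> Z \<Longrightarrow> \<not> adj z z'"
      using closer_extend[OF xy adj_sym[OF x'(1)] x'(2)] by blast
    then show ?thesis using regular_atI[OF xy] new IH by simp
  qed
  then show ?case using new IH by (auto simp: le_Suc_eq)
qed

lemma regular_everywhere: "x \<in> V \<Longrightarrow> y \<in> V \<Longrightarrow> regular_at x y"
  using drift_regular[OF dst_le] by blast

lemma m_eq_d: "m = d"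
proof -
  obtain x y where xy: "x \<in> V" "y \<in> V" "dst x y = d" using diam_attained by auto
  show ?thesis
    using regular_at_params(2)[OF xy regular_everywhere[OF xy(1,2)]] b_d sigma_pos by simp
qed

end

section \<open>Coordinates\<close>

text \<open>From here on eigenvalues and estimates are gone: the exact local picture at every pair
  of vertices, seen from a fixed base vertex, carries the whole argument.\<close>

locale hamming_like = local_cliques +
  fixes v\<^sub>0 :: 'a
  assumes regular: "\<lbrakk>x \<in> V; y \<in> V\<rbrakk> \<Longrightarrow> regular_at x y"
    and base: "v\<^sub>0 \<in> V"
begin

lemma closerD: "w \<in> closer x y \<Longrightarrow> adj y w \<and> dst x w + 1 = dst x y"
  by (simp add: closer_def)

lemma closer_nonadj: "\<lbrakk>x \<in> V; y \<in> V; z \<in> closer x y; z' \<in> closer x y\<rbrakk> \<Longrightarrow> \<not> adj z z'"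
  using regular[of x y] unfolding regular_at_def by blast

lemma card_closer_dst: "\<lbrakk>x \<in> V; y \<in> V\<rbrakk> \<Longrightarrow> card (closer x y) = dst x y"
  using regular[of x y] unfolding regular_at_def by blast

lemma dst_not_closer:
  "\<lbrakk>x \<in> V; y \<in> V; adj y w; w \<notin> closer x y\<rbrakk>
    \<Longrightarrow> dst x w = (if \<exists>z\<in>closer x y. adj z w then dst x y else dst x y + 1)"
  using regular[of x y] unfolding regular_at_def by blast

text \<open>A neighbour of \<open>y\<close> closer to \<open>x\<close> is also closer to
  \<open>x'\<close>, by the triangle inequality; the sizes are the distances, so exactly one vertex
  is added. It serves in two ways: with the base vertex as \<open>y\<close> it compares the
  coordinates of adjacent vertices, and with the base vertex as \<open>x\<close> it changes the
  viewpoint to a neighbour of the base.\<close>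

lemma closer_mono:
  assumes y: "y \<in> V" and xx': "adj x x'" and d: "dst x' y = dst x y + 1"
  obtains p where "p \<notin> closer x y" "closer x' y = insert p (closer x y)"
proof -
  have V: "x \<in> V" "x' \<in> V" using xx' adj_V adj_V2 by auto
  have sub: "closer x y \<subseteq> closer x' y"
  proof
    fix w assume w: "w \<in> closer x y"
    then have wV: "w \<in> V" using closerD adj_V2 by blast
    have "dst w x' \<le> dst w x + 1" using dst_step[OF wV xx'] .
    then have "dst x' w \<le> dst x w + 1" using dst_sym V wV by simp
    moreover have "dst x' y \<le> dst x' w + 1"
      using dst_step'[OF V(2), of y w] closerD[OF w] by simp
    ultimately show "w \<in> closer x' y" using closerD[OF w] d by (simp add: closer_def)
  qed
  have "card (closer x' y - closer x y) = 1"
    using card_Diff_subset[OF finite_closer sub] card_closer_dst[OF V(1) y] card_closer_dst[OF V(2) y] d by simp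
  then obtain p where "closer x' y - closer x y = {p}" by (auto simp: card_1_singleton_iff)
  then show ?thesis using that[of p] sub by blast
qed

text \<open>The coordinates of \<open>y\<close> in the lines through the base vertex are the neighbours of the base vertex
  that are closer to \<open>y\<close>; a line without such a neighbour has coordinate zero.\<close>
definition coord :: "'a \<Rightarrow> 'a set" where
  "coord y = closer y v\<^sub>0"

lemma coordD: "y \<in> V \<Longrightarrow> w \<in> coord y \<Longrightarrow> adj v\<^sub>0 w \<and> w \<in> V \<and> dst y w + 1 = dst y v\<^sub>0 \<and> dst w y + 1 = dst v\<^sub>0 y"
  unfolding coord_def using closerD[of w y "v\<^sub>0"] adj_V2[of "v\<^sub>0" w] dst_sym base by auto

lemma coord_nonadj: "\<lbrakk>y \<in> V; z \<in> coord y; z' \<in> coord y\<rbrakk> \<Longrightarrow> \<not> adj z z'"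
  unfolding coord_def using closer_nonadj base by blast

lemma card_coord: "y \<in> V \<Longrightarrow> card (coord y) = dst v\<^sub>0 y"
  unfolding coord_def using card_closer_dst base dst_sym by simp

lemma finite_coord: "finite (coord y)"
  by (simp add: coord_def)

lemma dst_off_coord:
  assumes "y \<in> V" "adj v\<^sub>0 w" "w \<notin> coord y" "\<And>z. z \<in> coord y \<Longrightarrow> \<not> adj z w"
  shows "dst w y = dst v\<^sub>0 y + 1"
proof -
  have wV: "w \<in> V" using assms adj_V2 by blast
  have "dst y w = dst y v\<^sub>0 + 1"
    using dst_not_closer[OF assms(1) base assms(2)] assms(3,4) unfolding coord_def by auto
  then show ?thesis using dst_sym assms(1) wV base by simp
qed

lemma dst_on_coord:
  assumes "y \<in> V" "adj v\<^sub>0 w" "z \<in> coord y" "adj z w"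
  shows "dst w y = dst v\<^sub>0 y"
proof -
  have wV: "w \<in> V" using assms adj_V2 by blast
  have "w \<notin> coord y" using coord_nonadj assms by blast
  then have "dst y w = dst y v\<^sub>0"
    using dst_not_closer[OF assms(1) base assms(2)] assms(3,4) unfolding coord_def by auto
  then show ?thesis using dst_sym assms(1) wV base by simp
qed

lemma coord_up:
  assumes "adj y y'" "dst v\<^sub>0 y' = dst v\<^sub>0 y + 1"
  obtains p where "p \<notin> coord y" "coord y' = insert p (coord y)"
  using closer_mono[OF base assms(1)] assms(2) dst_sym[OF base] adj_V[OF assms(1)] adj_V2[OF assms(1)]
  unfolding coord_def by metis

lemma coord_up_dst:
  assumes y: "y \<in> V" and p: "adj v\<^sub>0 p" "p \<notin> coord y" "y' \<in> V" "coord y' = insert p (coord y)"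
  shows "dst p y = dst v\<^sub>0 y + 1"
proof (rule dst_off_coord[OF y p(1,2)])
  fix z assume "z \<in> coord y"
  then show "\<not> adj z p" using coord_nonadj[OF p(3)] p(4) by blast
qed

text \<open>Regularity provides a common neighbour \<open>w\<close> one step nearer to the base, and
  \<open>y\<close>, \<open>y'\<close> add \<open>p\<close>, \<open>p'\<close> to its coordinates. If
  \<open>p = p'\<close>, then \<open>y\<close> and \<open>y'\<close> would be adjacent vertices of
  \<open>closer p w\<close>. If \<open>p\<close>, \<open>p'\<close> were distinct and nonadjacent,
  \<open>y'\<close> would be two steps farther from \<open>p\<close> than its neighbour
  \<open>y\<close>.\<close>

lemma coord_level:
  assumes yy': "adj y y'" and d: "dst v\<^sub>0 y' = dst v\<^sub>0 y"
  obtains W p p' where "p \<notin> W" "p' \<notin> W" "coord y = insert p W" "coord y' = insert p' W" "adj p p'"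
proof -
  have V: "y \<in> V" "y' \<in> V" using yy' adj_V adj_V2 by auto
  have "y' \<notin> closer v\<^sub>0 y" using closerD d by fastforce
  then obtain w where w: "w \<in> closer v\<^sub>0 y" "adj w y'"
    using dst_not_closer[OF base V(1) yy'] d by (metis n_not_Suc_n Suc_eq_plus1)
  have wy: "adj w y" "dst v\<^sub>0 y = dst v\<^sub>0 w + 1" "dst v\<^sub>0 y' = dst v\<^sub>0 w + 1"
    using closerD[OF w(1)] adj_sym d by auto
  have wV: "w \<in> V" using w(2) adj_V by blast
  obtain p where p: "p \<notin> coord w" "coord y = insert p (coord w)" using coord_up[OF wy(1,2)] .
  obtain p' where p': "p' \<notin> coord w" "coord y' = insert p' (coord w)" using coord_up[OF w(2) wy(3)] .
  have pD: "adj v\<^sub>0 p" "p \<in> V" "dst p y + 1 = dst v\<^sub>0 y" using coordD[OF V(1)] p(2) by auto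
  have pw: "dst p w = dst v\<^sub>0 w + 1" by (rule coord_up_dst[OF wV pD(1) p(1) V(1) p(2)])
  have pW: "\<not> adj z p" if "z \<in> coord w" for z using coord_nonadj[OF V(1)] p(2) that by blast
  have "p \<noteq> p'"
  proof
    assume "p = p'"
    then have "dst p y' + 1 = dst v\<^sub>0 y'" using coordD[OF V(2)] p'(2) by auto
    then have "y \<in> closer p w" "y' \<in> closer p w"
      using pw pD(3) wy w(2) d by (auto simp: closer_def)
    then show False using closer_nonadj[OF pD(2) wV] yy' by blast
  qed
  have "adj p p'"
  proof (rule ccontr)
    assume n: "\<not> adj p p'"
    have "dst p y' = dst v\<^sub>0 y' + 1"
    proof (rule dst_off_coord[OF V(2) pD(1)])
      show "p \<notin> coord y'" using p'(2) p(1) \<open>p \<noteq> p'\<close> by simp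
      fix z assume "z \<in> coord y'"
      then have "z = p' \<or> z \<in> coord w" using p'(2) by simp
      then show "\<not> adj z p" using pW n adj_sym[of p' p] by blast
    qed
    moreover have "dst p y' \<le> dst p y + 1" by (rule dst_step[OF pD(2) yy'])
    ultimately show False using pD(3) d by simp
  qed
  then show ?thesis using that p p' by blast
qed

text \<open>Stepping down from \<open>y'\<close> removes one coordinate; by induction different
  steps remove different ones, and by counting every coordinate can be removed. So \<open>y\<close>
  and \<open>y'\<close> can drop the same \<open>p\<close>, and by induction they reach the same
  \<open>z\<close>. Seen from \<open>p\<close> instead of the base, \<open>z\<close> acquires just
  one new closer neighbour, and both \<open>y\<close> and \<open>y'\<close> are such.\<close>

lemma coord_inj:
  assumes "y \<in> V" "y' \<in> V" "coord y = coord y'"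
  shows "y = y'"
proof -
  have "y = y'" if "y \<in> V" "y' \<in> V" "coord y = coord y'" "dst v\<^sub>0 y = n" for n y y'
    using that
  proof (induction n arbitrary: y y')
    case 0
    then have "dst v\<^sub>0 y' = 0" using card_coord by metis
    then show ?case using 0 dst_0 base by metis
  next
    case (Suc j)
    have d': "dst v\<^sub>0 y' = Suc j" using card_coord Suc.prems by metis
    have down: "\<exists>p. p \<notin> coord z \<and> coord v = insert p (coord z)"
      if "v \<in> V" "z \<in> closer v\<^sub>0 v" for v z
      using coord_up[of z v] closerD[OF that(2)] adj_sym by metis
    have lev: "z \<in> V \<and> adj z v \<and> dst v\<^sub>0 z = j" if "dst v\<^sub>0 v = Suc j" "z \<in> closer v\<^sub>0 v" for v z
      using closerD[OF that(2)] that(1) adj_sym adj_V2 by auto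
    have "closer v\<^sub>0 y \<noteq> {}" using card_closer_dst[OF base Suc.prems(1)] Suc.prems(4) by auto
    then obtain z where z: "z \<in> closer v\<^sub>0 y" by blast
    obtain p where p: "p \<notin> coord z" "coord y = insert p (coord z)" using down[OF Suc.prems(1) z] by blast
    obtain f where f: "\<And>z'. z' \<in> closer v\<^sub>0 y' \<Longrightarrow> f z' \<notin> coord z' \<and> coord y' = insert (f z') (coord z')"
      using down[OF Suc.prems(2)] by metis
    have "inj_on f (closer v\<^sub>0 y')"
    proof (rule inj_onI)
      fix v w assume vw: "v \<in> closer v\<^sub>0 y'" "w \<in> closer v\<^sub>0 y'" "f v = f w"
      then have "coord v = coord w" using f[OF vw(1)] f[OF vw(2)] by (metis Diff_insert_absorb)
      then show "v = w" using Suc.IH lev[OF d' vw(1)] lev[OF d' vw(2)] by blast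
    qed
    then have "card (f ` closer v\<^sub>0 y') = card (coord y')"
      using card_image card_closer_dst[OF base Suc.prems(2)] card_coord[OF Suc.prems(2)] by metis
    moreover have "f ` closer v\<^sub>0 y' \<subseteq> coord y'" using f by blast
    ultimately have "f ` closer v\<^sub>0 y' = coord y'" using card_subset_eq[OF finite_coord] by blast
    moreover have "p \<in> coord y'" using p Suc.prems(3) by blast
    ultimately obtain z' where z': "z' \<in> closer v\<^sub>0 y'" "p = f z'" by blast
    have "coord z = coord z'" using f[OF z'(1)] p z'(2) Suc.prems(3) by (metis Diff_insert_absorb)
    then have zz: "z = z'" using Suc.IH lev[OF Suc.prems(4) z] lev[OF d' z'(1)] by blast
    note lz = lev[OF Suc.prems(4) z] lev[OF d' z'(1)]
    have pD: "adj v\<^sub>0 p" "dst p y = j" "dst p y' = j"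
      using coordD[OF Suc.prems(1)] coordD[OF Suc.prems(2)] p(2) \<open>p \<in> coord y'\<close> Suc.prems(4) d' by auto
    have pz: "dst p z = dst v\<^sub>0 z + 1" using coord_up_dst[OF _ pD(1) p(1) Suc.prems(1) p(2)] lz by blast
    then obtain q where q: "closer p z = insert q (closer v\<^sub>0 z)"
      using closer_mono[OF _ pD(1) pz] lz by blast
    have "y \<in> closer p z" "y' \<in> closer p z" using pD pz lz zz by (auto simp: closer_def)
    moreover have "y \<notin> closer v\<^sub>0 z" "y' \<notin> closer v\<^sub>0 z"
      using closerD[of y "v\<^sub>0" z] closerD[of y' "v\<^sub>0" z] lz Suc.prems(4) d' by auto
    ultimately show ?case using q by auto
  qed
  then show ?thesis using assms by blast
qed

text \<open>The new vertex is the one neighbour \<open>v\<close> of \<open>y\<close> that becomes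
  closer when the viewpoint moves from the base to \<open>p\<close>. If \<open>v\<close> were on the
  level of \<open>y\<close>, one coordinate \<open>p1\<close> would be replaced by some
  \<open>p2\<close> in the same line, and the distance from \<open>p\<close> to \<open>v\<close>
  would force \<open>p2\<close> adjacent to \<open>p\<close>; then \<open>p\<close> lies in the line
  of \<open>p1\<close>, contrary to the assumption on \<open>p\<close>.\<close>

lemma coord_extend:
  assumes y: "y \<in> V" and p: "adj v\<^sub>0 p" "p \<notin> coord y" "\<And>w. w \<in> coord y \<Longrightarrow> \<not> adj w p"
  obtains y' where "adj y y'" "coord y' = insert p (coord y)"
proof -
  have pV: "p \<in> V" using p(1) adj_V2 by blast
  have py: "dst p y = dst v\<^sub>0 y + 1" by (rule dst_off_coord[OF y p])
  obtain v where v: "v \<notin> closer v\<^sub>0 y" "closer p y = insert v (closer v\<^sub>0 y)"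
    using closer_mono[OF y p(1) py] .
  then have vD: "adj y v" "dst p v = dst v\<^sub>0 y" using closerD[of v p y] py by auto
  have vV: "v \<in> V" using vD(1) adj_V2 by blast
  have "dst v\<^sub>0 v = dst v\<^sub>0 y + 1"
  proof (rule ccontr)
    assume n: "dst v\<^sub>0 v \<noteq> dst v\<^sub>0 y + 1"
    then have lv: "dst v\<^sub>0 v = dst v\<^sub>0 y"
      using dst_not_closer[OF base y vD(1) v(1)] by (auto split: if_splits)
    obtain W p1 p2 where W: "p1 \<notin> W" "p2 \<notin> W" "coord y = insert p1 W" "coord v = insert p2 W" "adj p1 p2"
      using coord_level[OF vD(1) lv] .
    have "p \<notin> coord v" using coordD[OF vV, of p] vD(2) lv by auto
    then obtain z where z: "z \<in> coord v" "adj z p"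
      using dst_off_coord[OF vV p(1)] vD(2) lv by force
    have "z = p2 \<or> z \<in> coord y" using z(1) W(3,4) by auto
    then have p2: "adj p2 p" using z(2) p(3) by metis
    have "p1 \<in> coord y" "p2 \<in> coord v" using W(3,4) by simp_all
    then have "adj v\<^sub>0 p1" "adj v\<^sub>0 p2" "p1 \<noteq> p" "\<not> adj p1 p"
      using coordD[OF y, of p1] coordD[OF vV, of p2] p(2) p(3)[of p1] by auto
    then show False using clique_trans[OF _ _ p(1) W(5) p2] by simp
  qed
  then obtain p' where p': "p' \<notin> coord y" "coord v = insert p' (coord y)" using coord_up[OF vD(1)] by metis
  have "dst v p + 1 = dst v v\<^sub>0"
    using vD(2) \<open>dst v\<^sub>0 v = dst v\<^sub>0 y + 1\<close> dst_sym[OF vV pV] dst_sym[OF vV base] by simp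
  then have "p \<in> coord v" using p(1) by (simp add: coord_def closer_def)
  then show ?thesis using that[of v] vD(1) p' p(2) by auto
qed

section \<open>Which coordinate sets occur, and adjacency in terms of coordinates\<close>

definition transversal :: "'a set \<Rightarrow> bool" where
  "transversal T \<longleftrightarrow> T \<subseteq> {w. adj v\<^sub>0 w} \<and> (\<forall>z\<in>T. \<forall>z'\<in>T. \<not> adj z z')"

lemma coord_transversal: "y \<in> V \<Longrightarrow> transversal (coord y)"
  unfolding transversal_def using coordD coord_nonadj by blast

lemma coord_surj:
  assumes "transversal T" obtains y where "y \<in> V" "coord y = T"
proof -
  have "finite T" using assms finite_nb' finite_subset unfolding transversal_def by blast
  then have "transversal T \<longrightarrow> (\<exists>y\<in>V. coord y = T)"
  proof induction
    case empty
    have "coord v\<^sub>0 = {}" using card_coord[OF base] base finite_coord by simp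
    then show ?case using base by blast
  next
    case (insert p T)
    show ?case
    proof
      assume tr: "transversal (insert p T)"
      then have "transversal T" unfolding transversal_def by blast
      then obtain y where y: "y \<in> V" "coord y = T" using insert by blast
      obtain y' where "adj y y'" "coord y' = insert p (coord y)"
        by (rule coord_extend[OF y(1), of p]) (use tr y insert in \<open>auto simp: transversal_def\<close>)
      then show "\<exists>y\<in>V. coord y = insert p T" using y adj_V2 by blast
    qed
  qed
  then show ?thesis using assms that by blast
qed

text \<open>Coordinate zero is encoded by absence, so changing a single coordinate takes three
  forms: away from zero, to zero, or between two nonzero letters of the same line.\<close>

definition one_change :: "'a set \<Rightarrow> 'a set \<Rightarrow> bool" where
  "one_change A B \<longleftrightarrow> (\<exists>p. p \<notin> A \<and> B = insert p A) \<or> (\<exists>p. p \<notin> B \<and> A = insert p B)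
    \<or> (\<exists>W p p'. p \<notin> W \<and> p' \<notin> W \<and> A = insert p W \<and> B = insert p' W \<and> adj p p')"

lemma adj_up:
  assumes "y \<in> V" "y' \<in> V" "p \<notin> coord y" "coord y' = insert p (coord y)"
  shows "adj y y'"
proof -
  have "adj v\<^sub>0 p" using coordD[OF assms(2)] assms(4) by blast
  moreover have "\<not> adj w p" if "w \<in> coord y" for w
    using coord_nonadj[OF assms(2)] assms(4) that by blast
  ultimately obtain v where v: "adj y v" "coord v = insert p (coord y)"
    using coord_extend[OF assms(1) _ assms(3)] by blast
  then have "v = y'" using coord_inj[of v y'] adj_V2[OF v(1)] assms by simp
  then show ?thesis using v by simp
qed

text \<open>The substantial case is the converse for a replaced coordinate. Both vertices lie above
  the vertex \<open>w\<close> with coordinates \<open>W\<close>. Seen from \<open>p'\<close>, the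
  only new closer neighbour of \<open>w\<close> is \<open>y'\<close>, and \<open>y\<close> is as far
  away as \<open>w\<close>. Regularity yields a vertex of \<open>closer p' w\<close> adjacent to
  \<open>y\<close>; one closer to the base than \<open>w\<close> would be two levels below
  \<open>y\<close>, so it is \<open>y'\<close>.\<close>

lemma adj_iff_one_change:
  assumes y: "y \<in> V" "y' \<in> V"
  shows "adj y y' \<longleftrightarrow> one_change (coord y) (coord y')"
proof
  assume a: "adj y y'"
  have "dst v\<^sub>0 y' \<le> dst v\<^sub>0 y + 1" "dst v\<^sub>0 y \<le> dst v\<^sub>0 y' + 1"
    using dst_step[OF base a] dst_step'[OF base a] by auto
  then consider "dst v\<^sub>0 y' = dst v\<^sub>0 y + 1" | "dst v\<^sub>0 y = dst v\<^sub>0 y' + 1" | "dst v\<^sub>0 y' = dst v\<^sub>0 y" by linarith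
  then show "one_change (coord y) (coord y')"
  proof cases
    case 1 then show ?thesis using coord_up[OF a] unfolding one_change_def by metis
  next
    case 2 then show ?thesis using coord_up[OF adj_sym[OF a]] unfolding one_change_def by metis
  next
    case 3 then show ?thesis using coord_level[OF a] unfolding one_change_def by metis
  qed
next
  assume "one_change (coord y) (coord y')"
  then consider p where "p \<notin> coord y" "coord y' = insert p (coord y)"
    | p where "p \<notin> coord y'" "coord y = insert p (coord y')"
    | W p p' where "p \<notin> W" "p' \<notin> W" "coord y = insert p W" "coord y' = insert p' W" "adj p p'"
    unfolding one_change_def by blast
  then show "adj y y'"
  proof cases
    case 1 then show ?thesis using adj_up y by blast
  next
    case 2 then show ?thesis using adj_up y adj_sym by blast
  next
    case 3
    have "transversal W" using coord_transversal[OF y(1)] 3(3) unfolding transversal_def by blast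
    then obtain w where w: "w \<in> V" "coord w = W" using coord_surj by blast
    have wy: "adj w y" "adj w y'" using adj_up[OF w(1) y(1)] adj_up[OF w(1) y(2)] w(2) 3 by blast+
    have finW: "finite W" using w(2) finite_coord by blast
    have d: "dst v\<^sub>0 y = dst v\<^sub>0 w + 1" "dst v\<^sub>0 y' = dst v\<^sub>0 w + 1"
      using card_coord[OF w(1)] card_coord[OF y(1)] card_coord[OF y(2)] 3 w(2) finW by simp_all
    have p': "adj v\<^sub>0 p'" "p' \<in> V" "dst p' y' = dst v\<^sub>0 w" using coordD[OF y(2), of p'] 3 d by auto
    have p'w: "dst p' w = dst v\<^sub>0 w + 1" using coord_up_dst[OF w(1) p'(1) _ y(2)] 3 w(2) by blast
    have p'y: "dst p' y = dst v\<^sub>0 y" using dst_on_coord[OF y(1) p'(1), of p] 3 by blast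
    obtain v where v: "closer p' w = insert v (closer v\<^sub>0 w)" using closer_mono[OF w(1) p'(1) p'w] by metis
    have "y' \<in> closer p' w" "y' \<notin> closer v\<^sub>0 w"
      using wy p'w p'(3) d closerD[of y' "v\<^sub>0" w] by (auto simp: closer_def)
    then have cl: "closer p' w = insert y' (closer v\<^sub>0 w)" using v by auto
    have "y \<notin> closer p' w" using closerD[of y p' w] p'y p'w d by auto
    then obtain z where z: "z \<in> closer p' w" "adj z y"
      using dst_not_closer[OF p'(2) w(1) wy(1)] p'y p'w d by (auto split: if_splits)
    have "z \<notin> closer v\<^sub>0 w"
      using closerD[of z "v\<^sub>0" w] dst_step[OF base z(2)] d by auto
    then have "z = y'" using z(1) cl by simp
    then show ?thesis using adj_sym[OF z(2)] by simp
  qed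
qed

end

section \<open>Numbering the lines and their points\<close>

context hamming_like
begin

text \<open>Each line through the base has \<sigma> points besides the base, so
  \<open>\<sigma> + 1\<close> letters suffice, with 0 for the base itself. Transversals then
  correspond to words of length \<open>m\<close>, and \<open>one_change\<close> to a difference in
  exactly one position.\<close>

lemma hamming_coding:
  assumes part: "partition_on {w. adj v\<^sub>0 w} P" "card P = m" "finite P"
    and cl: "\<And>z w. adj v\<^sub>0 z \<Longrightarrow> adj v\<^sub>0 w \<Longrightarrow> adj z w \<longleftrightarrow> z \<noteq> w \<and> (\<exists>C\<in>P. z \<in> C \<and> w \<in> C)"
  obtains f :: "'a \<Rightarrow> nat list" where
    "bij_betw f V {l. length l = m \<and> set l \<subseteq> {..<\<sigma> + 1}}"
    "\<And>y y'. y \<in> V \<Longrightarrow> y' \<in> V \<Longrightarrow> adj y y' \<longleftrightarrow> card {i. i < m \<and> f y ! i \<noteq> f y' ! i} = 1"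
proof -
  obtain C where C: "bij_betw C {..<m} P"
    using part(2,3) ex_bij_betw_nat_finite by (metis atLeast0LessThan)
  have CP: "C i \<in> P" if "i < m" for i using C that by (auto simp: bij_betw_def)
  have CD: "adj v\<^sub>0 w" if "i < m" "w \<in> C i" for i w
    using CP[OF that(1)] that(2) part(1) by (auto simp: partition_on_def)
  have disj: "i = i'" if "i < m" "i' < m" "w \<in> C i" "w \<in> C i'" for i i' w
  proof -
    have "C i = C i'"
      using part(1) CP[OF that(1)] CP[OF that(2)] that(3,4) by (auto simp: partition_on_def disjoint_def)
    then show ?thesis using C that(1,2) by (auto simp: bij_betw_def inj_on_def)
  qed
  have cover: "\<exists>i<m. w \<in> C i" if "adj v\<^sub>0 w" for w
  proof -
    have "w \<in> \<Union>P" using part(1) that by (simp add: partition_on_def)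
    then obtain D where "D \<in> P" "w \<in> D" by blast
    then show ?thesis using C by (auto simp: bij_betw_def)
  qed
  have adjC: "adj z w" if "i < m" "z \<in> C i" "w \<in> C i" "z \<noteq> w" for i z w
    using cl[of z w] CD that CP by blast
  have Cadj: "w \<in> C i" if "i < m" "z \<in> C i" "adj z w" "adj v\<^sub>0 w" for i z w
  proof -
    have "\<exists>D\<in>P. z \<in> D \<and> w \<in> D" using cl[of z w] CD[OF that(1,2)] that(3,4) by blast
    then obtain D where D: "D \<in> P" "z \<in> D" "w \<in> D" by blast
    then obtain i' where "i' < m" "D = C i'" using C by (auto simp: bij_betw_def)
    then show ?thesis using disj[of i i' z] that(1,2) D by simp
  qed
  have cardC: "card (C i) = \<sigma>" if "i < m" for i
  proof -
    have "C i \<noteq> {}" using CP[OF that] part(1) by (auto simp: partition_on_def)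
    then obtain z where z: "z \<in> C i" by blast
    have "C i = insert z {w. adj v\<^sub>0 w \<and> adj z w}"
    proof
      show "C i \<subseteq> insert z {w. adj v\<^sub>0 w \<and> adj z w}" using adjC[OF that z] CD[OF that] by blast
      show "insert z {w. adj v\<^sub>0 w \<and> adj z w} \<subseteq> C i" using Cadj[OF that z] z by blast
    qed
    then show ?thesis using card_adj2[OF CD[OF that z]] adj_irrefl by simp
  qed
  have "\<exists>g. bij_betw g (C i) {1..\<sigma>}" if "i < m" for i
  proof -
    have "finite (C i)" using cardC[OF that] sigma_pos card_ge_0_finite[of "C i"] by simp
    then show ?thesis using finite_same_card_bij[of "C i" "{1..\<sigma>}"] cardC[OF that] by simp
  qed
  then obtain g where g: "\<And>i. i < m \<Longrightarrow> bij_betw (g i) (C i) {1..\<sigma>}" by metis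
  have gpos: "1 \<le> g i w" "g i w \<le> \<sigma>" if "i < m" "w \<in> C i" for i w
    using bij_betw_apply[OF g[OF that(1)] that(2)] by auto
  have ginj: "w = w'" if "i < m" "w \<in> C i" "w' \<in> C i" "g i w = g i w'" for i w w'
    using g[OF that(1)] that(2-4) by (auto simp: bij_betw_def inj_on_def)
  have sub: "adj v\<^sub>0 w" if "transversal T" "w \<in> T" for T w
    using that unfolding transversal_def by auto
  \<comment> \<open>A transversal meets a line in at most one point, so the sum is the label of that
    point, or 0 if there is none. Labels start at 1 to keep 0 free for this default.\<close>
  define cd where "cd i T = (\<Sum>w\<in>T \<inter> C i. g i w)" for i T
  have cd1: "cd i T = g i w" if "transversal T" "i < m" "w \<in> T" "w \<in> C i" for i T w
  proof -
    have "T \<inter> C i = {w}" using that adjC[OF that(2)] unfolding transversal_def by blast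
    then show ?thesis by (simp add: cd_def)
  qed
  have cd0: "cd i T = 0" if "T \<inter> C i = {}" for i T using that by (simp add: cd_def)
  have slice: "T \<inter> C i = {w \<in> C i. g i w = cd i T}" if T: "transversal T" and i: "i < m" for i T
  proof (cases "T \<inter> C i = {}")
    case True
    then show ?thesis using cd0[OF True] gpos[OF i] by fastforce
  next
    case False
    then obtain w where w: "w \<in> T" "w \<in> C i" by blast
    have "T \<inter> C i = {w}" using T w adjC[OF i] unfolding transversal_def by blast
    moreover have "{v \<in> C i. g i v = g i w} = {w}" using ginj[OF i _ w(2)] w(2) by blast
    ultimately show ?thesis using cd1[OF T i w] by simp
  qed
  have cdle: "cd i T < \<sigma> + 1" if T: "transversal T" and i: "i < m" for i T
  proof (cases "T \<inter> C i = {}")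
    case False
    then show ?thesis using cd1[OF T i] gpos[OF i] by fastforce
  qed (simp add: cd0)
  have eqI: "T = T'" if T: "transversal T" "transversal T'" and e: "\<And>i. i < m \<Longrightarrow> cd i T = cd i T'" for T T'
  proof -
    have "w \<in> T \<longleftrightarrow> w \<in> T'" if w: "adj v\<^sub>0 w" for w
    proof -
      obtain i where i: "i < m" "w \<in> C i" using cover[OF w] by blast
      have "T \<inter> C i = T' \<inter> C i" using slice[OF T(1) i(1)] slice[OF T(2) i(1)] e[OF i(1)] by simp
      then show ?thesis using i(2) by blast
    qed
    then show ?thesis using sub[OF T(1)] sub[OF T(2)] by blast
  qed
  have diff: "{i. i < m \<and> cd i T \<noteq> cd i T'} = {j}" if "transversal T" "transversal T'" "j < m"
    "T - C j = T' - C j" "T \<noteq> T'" for T T' j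
  proof -
    have "cd i T = cd i T'" if "i < m" "i \<noteq> j" for i
    proof -
      have "T \<inter> C i = T' \<inter> C i" using \<open>T - C j = T' - C j\<close> disj[OF that(1) \<open>j < m\<close>] that(2) by blast
      then show ?thesis by (simp add: cd_def)
    qed
    moreover have "cd j T \<noteq> cd j T'" using eqI[OF \<open>transversal T\<close> \<open>transversal T'\<close>] calculation \<open>T \<noteq> T'\<close> by blast
    ultimately show ?thesis using \<open>j < m\<close> by blast
  qed
  have change: "one_change T T' \<longleftrightarrow> card {i. i < m \<and> cd i T \<noteq> cd i T'} = 1"
    if T: "transversal T" "transversal T'" for T T'
  proof
    assume "one_change T T'"
    then have "\<exists>j<m. T - C j = T' - C j \<and> T \<noteq> T'"
    proof -
      consider p where "p \<notin> T" "T' = insert p T" | p where "p \<notin> T'" "T = insert p T'"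
        | W p p' where "p \<notin> W" "p' \<notin> W" "T = insert p W" "T' = insert p' W" "adj p p'"
        using \<open>one_change T T'\<close> unfolding one_change_def by blast
      then show ?thesis
      proof cases
        case 1
        then obtain j where "j < m" "p \<in> C j" using cover sub[OF T(2), of p] by auto
        then show ?thesis using 1 by (intro exI[of _ j]) auto
      next
        case 2
        then obtain j where "j < m" "p \<in> C j" using cover sub[OF T(1), of p] by auto
        then show ?thesis using 2 by (intro exI[of _ j]) auto
      next
        case 3
        have o: "adj v\<^sub>0 p" "adj v\<^sub>0 p'" using sub[OF T(1), of p] sub[OF T(2), of p'] 3(3,4) by auto
        then obtain j where j: "j < m" "p \<in> C j" using cover by blast
        have "p' \<in> C j" using Cadj[OF j 3(5) o(2)] .
        then show ?thesis using 3(1-4) j adj_neq[OF 3(5)] by (intro exI[of _ j]) auto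
      qed
    qed
    then show "card {i. i < m \<and> cd i T \<noteq> cd i T'} = 1" using diff[OF T] by fastforce
  next
    assume "card {i. i < m \<and> cd i T \<noteq> cd i T'} = 1"
    then obtain j where j: "{i. i < m \<and> cd i T \<noteq> cd i T'} = {j}" by (auto simp: card_1_singleton_iff)
    then have jm: "j < m" "cd j T \<noteq> cd j T'" by blast+
    have e: "T \<inter> C i = T' \<inter> C i" if "i < m" "i \<noteq> j" for i
    proof -
      have "cd i T = cd i T'" using j that by blast
      then show ?thesis using slice[OF T(1) that(1)] slice[OF T(2) that(1)] by simp
    qed
    define W where "W = T - C j"
    have "w \<in> T \<longleftrightarrow> w \<in> T'" if w: "adj v\<^sub>0 w" "w \<notin> C j" for w
    proof -
      obtain i where i: "i < m" "w \<in> C i" using cover[OF w(1)] by blast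
      then have "i \<noteq> j" using w(2) by blast
      then show ?thesis using e[OF i(1)] i(2) by blast
    qed
    then have W: "W = T' - C j" unfolding W_def using sub[OF T(1)] sub[OF T(2)] by blast
    have Wj: "p \<notin> W" if "p \<in> C j" for p using that W_def by blast
    have TW: "T = (T \<inter> C j) \<union> W" "T' = (T' \<inter> C j) \<union> W" using W W_def by blast+
    have single: "S \<inter> C j = {} \<or> (\<exists>p\<in>C j. S \<inter> C j = {p})" if "transversal S" for S
      using that adjC[OF jm(1)] unfolding transversal_def by blast
    have ne: "T \<inter> C j \<noteq> T' \<inter> C j" using jm(2) unfolding cd_def by metis
    consider "T \<inter> C j = {}" "T' \<inter> C j = {}" | p where "T \<inter> C j = {}" "p \<in> C j" "T' \<inter> C j = {p}"
      | p where "T' \<inter> C j = {}" "p \<in> C j" "T \<inter> C j = {p}"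
      | p p' where "p \<in> C j" "p' \<in> C j" "T \<inter> C j = {p}" "T' \<inter> C j = {p'}"
      using single[OF T(1)] single[OF T(2)] by blast
    then show "one_change T T'"
    proof cases
      case 1
      then show ?thesis using ne by simp
    next
      case 2
      then have "T = W" "T' = insert p W" "p \<notin> W" using TW Wj by auto
      then show ?thesis unfolding one_change_def by blast
    next
      case 3
      then have "T' = W" "T = insert p W" "p \<notin> W" using TW Wj by auto
      then show ?thesis unfolding one_change_def by blast
    next
      case 4
      then have "T = insert p W" "T' = insert p' W" "p \<notin> W" "p' \<notin> W" using TW Wj by auto
      moreover have "adj p p'" using adjC[OF jm(1) 4(1,2)] 4(3,4) ne by auto
      ultimately show ?thesis unfolding one_change_def by blast
    qed
  qed
  define f where "f y = map (\<lambda>i. cd i (coord y)) [0..<m]" for y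
  have fi: "f y ! i = cd i (coord y)" if "i < m" for y i using that by (simp add: f_def)
  show ?thesis
  proof (rule that[of f])
    show "bij_betw f V {l. length l = m \<and> set l \<subseteq> {..<\<sigma> + 1}}"
    proof (rule bij_betw_imageI)
      show "inj_on f V"
      proof (rule inj_onI)
        fix y y' assume y: "y \<in> V" "y' \<in> V" "f y = f y'"
        have "coord y = coord y'"
          by (rule eqI[OF coord_transversal[OF y(1)] coord_transversal[OF y(2)]]) (metis fi y(3))
        then show "y = y'" using coord_inj y by blast
      qed
      show "f ` V = {l. length l = m \<and> set l \<subseteq> {..<\<sigma> + 1}}"
      proof
        show "f ` V \<subseteq> {l. length l = m \<and> set l \<subseteq> {..<\<sigma> + 1}}"
          using cdle[OF coord_transversal] by (fastforce simp: f_def)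
        show "{l. length l = m \<and> set l \<subseteq> {..<\<sigma> + 1}} \<subseteq> f ` V"
        proof
          fix l :: "nat list" assume "l \<in> {l. length l = m \<and> set l \<subseteq> {..<\<sigma> + 1}}"
          then have l: "length l = m" "\<And>i. i < m \<Longrightarrow> l ! i \<le> \<sigma>" using nth_mem by fastforce+
          define T where "T = {w. \<exists>i<m. w \<in> C i \<and> g i w = l ! i}"
          have Ti: "T \<inter> C i = {w \<in> C i. g i w = l ! i}" if "i < m" for i
            using disj that by (auto simp: T_def)
          have "\<not> adj z z'" if z: "z \<in> T" "z' \<in> T" for z z'
          proof
            assume a: "adj z z'"
            obtain i i' where i: "i < m" "z \<in> C i" "g i z = l ! i" "i' < m" "z' \<in> C i'" "g i' z' = l ! i'"
              using z by (auto simp: T_def)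
            have "z' \<in> C i" using Cadj[OF i(1,2) a CD[OF i(4,5)]] .
            then have "i = i'" using disj i by blast
            then have "z = z'" using ginj[OF i(1,2)] i by simp
            then show False using a adj_irrefl by simp
          qed
          moreover have "T \<subseteq> {w. adj v\<^sub>0 w}" using CD by (auto simp: T_def)
          ultimately have tr: "transversal T" unfolding transversal_def by blast
          obtain y where y: "y \<in> V" "coord y = T" using coord_surj[OF tr] .
          have "cd i T = l ! i" if i: "i < m" for i
          proof (cases "l ! i = 0")
            case True
            then have "T \<inter> C i = {}" using Ti[OF i] gpos(1)[OF i] by fastforce
            then show ?thesis using cd0 True by simp
          next
            case False
            then have "l ! i \<in> g i ` C i" using g[OF i] l(2)[OF i] by (auto simp: bij_betw_def)
            then obtain w where "w \<in> C i" "g i w = l ! i" by auto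
            then show ?thesis using cd1[OF tr i, of w] Ti[OF i] by auto
          qed
          then have "f y = l" using y l(1) by (auto simp: f_def intro: nth_equalityI)
          then show "l \<in> f ` V" using y(1) by blast
        qed
      qed
    qed
    show "adj y y' \<longleftrightarrow> card {i. i < m \<and> f y ! i \<noteq> f y' ! i} = 1" if "y \<in> V" "y' \<in> V" for y y'
    proof -
      have "{i. i < m \<and> f y ! i \<noteq> f y' ! i} = {i. i < m \<and> cd i (coord y) \<noteq> cd i (coord y')}"
        using fi by auto
      then show ?thesis
        using adj_iff_one_change[OF that] change[OF that[THEN coord_transversal]] by simp
    qed
  qed
qed

end

section \<open>Adjacency eigenvalues\<close>

lemma trace_mult_commute:
  fixes A B :: "'a :: comm_semiring_0 mat"
  assumes "A \<in> carrier_mat n n" "B \<in> carrier_mat n n"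
  shows "(\<Sum>i<n. (A * B) $$ (i, i)) = (\<Sum>i<n. (B * A) $$ (i, i))"
proof -
  have "(\<Sum>i<n. (A * B) $$ (i, i)) = (\<Sum>i<n. \<Sum>j<n. A $$ (i, j) * B $$ (j, i))"
    using assms by (intro sum.cong) (auto simp: scalar_prod_def atLeast0LessThan)
  also have "\<dots> = (\<Sum>j<n. \<Sum>i<n. A $$ (i, j) * B $$ (j, i))" by (rule sum.swap)
  also have "\<dots> = (\<Sum>i<n. (B * A) $$ (i, i))"
    using assms by (intro sum.cong) (auto simp: scalar_prod_def atLeast0LessThan mult.commute)
  finally show ?thesis .
qed

text \<open>Similarity preserves the trace, and the diagonal of the Schur form lists the
  roots.\<close>

lemma trace_eq_sum_roots:
  fixes A :: "complex mat"
  assumes A: "A \<in> carrier_mat n n" and es: "char_poly A = (\<Prod>e\<leftarrow>es. [:- e, 1:])"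
  shows "(\<Sum>i<n. A $$ (i, i)) = sum_list es"
proof -
  obtain B P Q where BPQ: "schur_decomposition A es = (B, P, Q)" by (cases "schur_decomposition A es") auto
  have w: "similar_mat_wit A B P Q" and d: "diag_mat B = es"
    using schur_decomposition[OF A es BPQ] by auto
  note D = similar_mat_witD2[OF A w]
  have "(\<Sum>i<n. A $$ (i, i)) = (\<Sum>i<n. (P * (B * Q)) $$ (i, i))"
    using D assoc_mult_mat[of P n n B n Q n] by simp
  also have "\<dots> = (\<Sum>i<n. ((B * Q) * P) $$ (i, i))"
    by (rule trace_mult_commute) (use D in auto)
  also have "(B * Q) * P = B"
    using D assoc_mult_mat[of B n n Q n P n] by simp
  also have "(\<Sum>i<n. B $$ (i, i)) = sum_list (diag_mat B)"
    using D by (simp add: diag_mat_def interv_sum_list_conv_sum_set_nat atLeast0LessThan)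
  finally show ?thesis using d by simp
qed

text \<open>The Hermitian form of an eigenvector is its own conjugate by symmetry, and equals
  \<open>e\<close> times a positive real number.\<close>

lemma symmetric_eigenvalue_real:
  fixes A :: "real mat"
  assumes A: "A \<in> carrier_mat n n" and sym: "\<And>i j. i < n \<Longrightarrow> j < n \<Longrightarrow> A $$ (i, j) = A $$ (j, i)"
    and e: "eigenvalue (map_mat complex_of_real A) e"
  shows "e \<in> \<real>"
proof -
  let ?A = "map_mat complex_of_real A"
  obtain v where v: "v \<in> carrier_vec n" "v \<noteq> 0\<^sub>v n" "?A *\<^sub>v v = e \<cdot>\<^sub>v v"
    using e A unfolding eigenvalue_def eigenvector_def by auto
  have row: "(\<Sum>j<n. complex_of_real (A $$ (i, j)) * v $ j) = e * v $ i" if "i < n" for i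
  proof -
    have "(?A *\<^sub>v v) $ i = (e \<cdot>\<^sub>v v) $ i" using v by simp
    then show ?thesis using A v(1) that by (simp add: scalar_prod_def atLeast0LessThan)
  qed
  define S where "S = (\<Sum>i<n. \<Sum>j<n. complex_of_real (A $$ (i, j)) * (cnj (v $ i) * v $ j))"
  have "cnj S = (\<Sum>i<n. \<Sum>j<n. complex_of_real (A $$ (j, i)) * (cnj (v $ j) * v $ i))"
    unfolding S_def cnj_sum
    by (intro sum.cong refl) (use sym in \<open>simp add: mult.commute\<close>)
  also have "\<dots> = S" unfolding S_def by (rule sum.swap)
  finally have Sr: "S \<in> \<real>" by (simp add: complex_is_Real_iff complex_eq_iff)
  define N where "N = (\<Sum>i<n. (cmod (v $ i))\<^sup>2)"
  have "S = (\<Sum>i<n. cnj (v $ i) * (e * v $ i))"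
    unfolding S_def by (intro sum.cong refl) (simp add: row[symmetric] sum_distrib_left mult_ac)
  also have "\<dots> = e * complex_of_real N"
    unfolding N_def of_real_sum sum_distrib_left
    by (intro sum.cong refl) (simp add: complex_norm_square[symmetric] mult_ac)
  finally have SN: "S = e * complex_of_real N" .
  obtain i where i: "i < n" "v $ i \<noteq> 0" using v(1,2) by (metis carrier_vecD eq_vecI index_zero_vec(1,2))
  have "0 < (cmod (v $ i))\<^sup>2" using i by simp
  also have "\<dots> \<le> N" unfolding N_def by (rule member_le_sum) (use i in auto)
  finally have "e = S / complex_of_real N" using SN by simp
  then show ?thesis using Sr by simp
qed

text \<open>Otherwise all complex roots of the characteristic polynomial, being real eigenvalues,
  would equal \<open>k\<close>, and the trace would be \<open>n * k \<noteq> 0\<close>.\<close>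

lemma symmetric_trace_zero_eigenvalue:
  fixes A :: "real mat"
  assumes A: "A \<in> carrier_mat n n" and sym: "\<And>i j. i < n \<Longrightarrow> j < n \<Longrightarrow> A $$ (i, j) = A $$ (j, i)"
    and tr: "(\<Sum>i<n. A $$ (i, i)) = 0" and k: "k \<noteq> 0" and n: "0 < n"
  shows "\<exists>\<theta>. \<theta> \<noteq> k \<and> eigenvalue A \<theta>"
proof (rule ccontr)
  assume no: "\<not> (\<exists>\<theta>. \<theta> \<noteq> k \<and> eigenvalue A \<theta>)"
  let ?A = "map_mat complex_of_real A"
  have A': "?A \<in> carrier_mat n n" using A by simp
  obtain es where es: "char_poly ?A = (\<Prod>e\<leftarrow>es. [:- e, 1:])" "length es = n"
    using char_poly_factorized[OF A'] by blast
  have "e = complex_of_real k" if "e \<in> set es" for e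
  proof -
    have root: "poly (char_poly ?A) e = 0"
      using that unfolding es(1) poly_prod_list by (auto simp: prod_list_zero_iff)
    then have "eigenvalue ?A e" using eigenvalue_root_char_poly[OF A'] by simp
    then obtain \<theta> where \<theta>: "e = complex_of_real \<theta>"
      using symmetric_eigenvalue_real[OF A sym] by (auto simp: Reals_def)
    have "poly (map_poly complex_of_real (char_poly A)) (complex_of_real \<theta>) = 0"
      using root \<theta> of_real_hom.char_poly_hom[OF A] by metis
    then have "poly (char_poly A) \<theta> = 0" by simp
    then have "eigenvalue A \<theta>" using eigenvalue_root_char_poly[OF A] by simp
    then show ?thesis using no \<theta> by auto
  qed
  then have "es = replicate n (complex_of_real k)" using es(2) by (simp add: replicate_eqI)
  then have "sum_list es = of_nat n * complex_of_real k" by (simp add: sum_list_replicate)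
  moreover have "sum_list es = complex_of_real (\<Sum>i<n. A $$ (i, i))"
    using trace_eq_sum_roots[OF A' es(1)] A by simp
  ultimately show False using tr k n by simp
qed

lemma adj_mat_carrier: "adj_mat G vs \<in> carrier_mat (length vs) (length vs)"
  by (simp add: adj_mat_def)

lemma adj_mat_mult:
  assumes vs: "distinct vs" "set vs = pverts G" and v: "v \<in> carrier_vec (length vs)" and i: "i < length vs"
    and wf: "parcs G \<subseteq> pverts G \<times> pverts G"
    and h: "\<And>j. j < length vs \<Longrightarrow> h (vs ! j) = v $ j"
  shows "(adj_mat G vs *\<^sub>v v) $ i = (\<Sum>w | (vs ! i, w) \<in> parcs G. h w)"
proof -
  have "(adj_mat G vs *\<^sub>v v) $ i
      = (\<Sum>j<length vs. (if (vs ! i, vs ! j) \<in> parcs G then h (vs ! j) else 0))"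
    using v i h by (auto simp: adj_mat_def scalar_prod_def atLeast0LessThan intro!: sum.cong)
  also have "\<dots> = (\<Sum>w\<in>pverts G. if (vs ! i, w) \<in> parcs G then h w else 0)"
    using sum.reindex_bij_betw[OF bij_betw_nth[OF vs(1) refl vs(2)[symmetric]],
        of "\<lambda>w. if (vs ! i, w) \<in> parcs G then h w else 0"] .
  also have "\<dots> = (\<Sum>w | w \<in> pverts G \<and> (vs ! i, w) \<in> parcs G. h w)"
    using vs(2) by (subst sum.inter_filter) (auto simp flip: vs(2))
  also have "{w. w \<in> pverts G \<and> (vs ! i, w) \<in> parcs G} = {w. (vs ! i, w) \<in> parcs G}" using wf by blast
  finally show ?thesis .
qed

lemma adj_eigenvalue_function:
  assumes wf: "parcs G \<subseteq> pverts G \<times> pverts G" and \<theta>: "\<theta> \<in> adj_eigenvalues G"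
  shows "\<exists>h. (\<exists>x\<in>pverts G. h x \<noteq> 0)
    \<and> (\<forall>y\<in>pverts G. (\<Sum>w | (y, w) \<in> parcs G. h w) = \<theta> * h y)"
proof -
  obtain vs where vs: "distinct vs" "set vs = pverts G" "eigenvalue (adj_mat G vs) \<theta>"
    using \<theta> by (auto simp: adj_eigenvalues_def)
  let ?n = "length vs"
  obtain v where v: "v \<in> carrier_vec ?n" "v \<noteq> 0\<^sub>v ?n" "adj_mat G vs *\<^sub>v v = \<theta> \<cdot>\<^sub>v v"
    using vs(3) adj_mat_carrier[of G vs] unfolding eigenvalue_def eigenvector_def by auto
  define h where "h y = v $ (the_inv_into {..<?n} ((!) vs) y)" for y
  have inj: "inj_on ((!) vs) {..<?n}" using vs(1) by (auto simp: inj_on_def nth_eq_iff_index_eq)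
  have h: "h (vs ! j) = v $ j" if "j < ?n" for j
    using the_inv_into_f_f[OF inj] that by (simp add: h_def)
  obtain i where i: "i < ?n" "v $ i \<noteq> 0" using v(1,2) by (metis carrier_vecD eq_vecI index_zero_vec(1,2))
  show ?thesis
  proof (intro exI[of _ h] conjI ballI)
    show "\<exists>x\<in>pverts G. h x \<noteq> 0" using h[OF i(1)] i vs(2) nth_mem by metis
    fix y assume "y \<in> pverts G"
    then obtain j where j: "j < ?n" "y = vs ! j" using vs(2) by (metis in_set_conv_nth)
    have "(\<Sum>w | (y, w) \<in> parcs G. h w) = (adj_mat G vs *\<^sub>v v) $ j"
      using adj_mat_mult[OF vs(1,2) v(1) j(1) wf h] j(2) by simp
    then show "(\<Sum>w | (y, w) \<in> parcs G. h w) = \<theta> * h y" using v(1,3) h[OF j(1)] j by simp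
  qed
qed

text \<open>The set ranges over all enumerations of the vertices; there are finitely many of them,
  so their spectra need not be compared.\<close>

lemma finite_adj_eigenvalues:
  assumes "finite (pverts G)" shows "finite (adj_eigenvalues G)"
proof -
  let ?L = "{vs. set vs \<subseteq> pverts G \<and> length vs = card (pverts G)}"
  have "adj_eigenvalues G \<subseteq> (\<Union>vs\<in>?L. spectrum (adj_mat G vs))"
    by (auto simp: adj_eigenvalues_def spectrum_def distinct_card[symmetric])
  moreover have "finite (\<Union>vs\<in>?L. spectrum (adj_mat G vs))"
    using finite_lists_length_eq[OF assms] card_finite_spectrum(1)[OF adj_mat_carrier] by blast
  ultimately show ?thesis by (rule finite_subset)
qed

text \<open>The eigenvalue equation is read at a vertex where \<open>\<bar>h\<bar>\<close> is
  maximal.\<close>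

lemma adj_eigenvalue_le:
  assumes fin: "finite (pverts G)" and wf: "parcs G \<subseteq> pverts G \<times> pverts G"
    and reg: "\<forall>y\<in>pverts G. card {w. (y, w) \<in> parcs G} = k" and \<theta>: "\<theta> \<in> adj_eigenvalues G"
  shows "\<theta> \<le> real k"
proof -
  obtain h where h: "\<exists>x\<in>pverts G. h x \<noteq> 0"
    "\<And>y. y \<in> pverts G \<Longrightarrow> (\<Sum>w | (y, w) \<in> parcs G. h w) = \<theta> * h y"
    using adj_eigenvalue_function[OF wf \<theta>] by auto
  define M where "M = Max ((\<lambda>y. \<bar>h y\<bar>) ` pverts G)"
  have le: "\<bar>h y\<bar> \<le> M" if "y \<in> pverts G" for y unfolding M_def using fin that by (intro Max_ge) auto
  have "pverts G \<noteq> {}" using h(1) by blast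
  then have "M \<in> (\<lambda>y. \<bar>h y\<bar>) ` pverts G" unfolding M_def using fin by (intro Max_in) auto
  then obtain y where y: "y \<in> pverts G" "\<bar>h y\<bar> = M" by auto
  have M: "0 < M" using h(1) le by fastforce
  have "\<bar>\<theta>\<bar> * M = \<bar>\<Sum>w | (y, w) \<in> parcs G. h w\<bar>" using h(2)[OF y(1)] y(2) by (simp add: abs_mult)
  also have "\<dots> \<le> (\<Sum>w | (y, w) \<in> parcs G. \<bar>h w\<bar>)" by (rule sum_abs)
  also have "\<dots> \<le> (\<Sum>w | (y, w) \<in> parcs G. M)" by (rule sum_mono) (use le wf in auto)
  also have "\<dots> = real k * M" using reg y(1) by simp
  finally show ?thesis using M by simp
qed

text \<open>\<open>theta G 1\<close> is a list entry, meaningful only if two distinct eigenvalues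
  exist. The valency is one of them, with the constant eigenvector, and zero trace forces another.
  The list is strictly decreasing and its head is at most the valency.\<close>

lemma theta_1_less:
  assumes fin: "finite (pverts G)" and ne: "pverts G \<noteq> {}"
    and wf: "parcs G \<subseteq> pverts G \<times> pverts G"
    and sym: "\<And>x y. (x, y) \<in> parcs G \<Longrightarrow> (y, x) \<in> parcs G" and irr: "\<And>x. (x, x) \<notin> parcs G"
    and reg: "\<forall>y\<in>pverts G. card {w. (y, w) \<in> parcs G} = k" and k: "0 < k"
  shows "theta G 1 \<in> adj_eigenvalues G" "theta G 1 < real k"
proof -
  let ?S = "adj_eigenvalues G"
  obtain vs where vs: "distinct vs" "set vs = pverts G" using finite_distinct_list[OF fin] by metis
  let ?n = "length vs" and ?A = "adj_mat G vs"
  have n: "0 < ?n" using ne vs(2) by auto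
  note A = adj_mat_carrier[of G vs]
  have kS: "real k \<in> ?S"
  proof -
    let ?v = "vec ?n (\<lambda>_. 1 :: real)"
    have "?A *\<^sub>v ?v = real k \<cdot>\<^sub>v ?v"
    proof (rule eq_vecI)
      show "dim_vec (?A *\<^sub>v ?v) = dim_vec (real k \<cdot>\<^sub>v ?v)" using A by simp
      fix i assume "i < dim_vec (real k \<cdot>\<^sub>v ?v)"
      then have i: "i < ?n" by simp
      have "(?A *\<^sub>v ?v) $ i = (\<Sum>w | (vs ! i, w) \<in> parcs G. 1)"
        by (rule adj_mat_mult[OF vs _ i wf]) auto
      then show "(?A *\<^sub>v ?v) $ i = (real k \<cdot>\<^sub>v ?v) $ i" using reg i vs(2) nth_mem[OF i] by simp
    qed
    moreover have "?v \<noteq> 0\<^sub>v ?n" using n by (metis index_vec index_zero_vec(1) zero_neq_one)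
    ultimately have "eigenvalue ?A (real k)"
      unfolding eigenvalue_def eigenvector_def using A by (intro exI[of _ ?v]) auto
    then show ?thesis unfolding adj_eigenvalues_def using vs by blast
  qed
  obtain \<theta> where \<theta>: "\<theta> \<noteq> real k" "eigenvalue ?A \<theta>"
  proof -
    have "\<exists>\<theta>. \<theta> \<noteq> real k \<and> eigenvalue ?A \<theta>"
    proof (rule symmetric_trace_zero_eigenvalue[OF A])
      fix i j assume "i < ?n" "j < ?n"
      then show "?A $$ (i, j) = ?A $$ (j, i)" using sym by (auto simp: adj_mat_def)
    qed (use irr k n in \<open>simp_all add: adj_mat_def\<close>)
    then show ?thesis using that by blast
  qed
  then have "\<theta> \<in> ?S" unfolding adj_eigenvalues_def using vs by blast
  then have "card {\<theta>, real k} \<le> card ?S"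
    using kS by (intro card_mono finite_adj_eigenvalues[OF fin]) auto
  then have two: "2 \<le> card ?S" using \<theta>(1) by simp
  let ?l = "sorted_list_of_set ?S"
  have len: "length ?l = card ?S" by simp
  have set: "set ?l = ?S" using finite_adj_eigenvalues[OF fin] by simp
  have th: "theta G i = ?l ! (card ?S - Suc i)" if "i < 2" for i
    using that two len by (simp add: theta_def rev_nth)
  have mem: "theta G i \<in> ?S" if "i < 2" for i
    using th[OF that] two nth_mem[of "card ?S - Suc i" ?l] set len by auto
  show "theta G 1 \<in> ?S" using mem by simp
  have "theta G 1 < theta G 0"
    using th[of 1] th[of 0] two len
    sorted_wrt_nth_less[OF strict_sorted_list_of_set[of ?S], of "card ?S - 2" "card ?S - 1"]
    by (simp add: numeral_2_eq_2)
  moreover have "theta G 0 \<le> real k" using adj_eigenvalue_le[OF fin wf reg] mem by simp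
  ultimately show "theta G 1 < real k" by simp
qed

section \<open>Graph distance and the Hamming graph\<close>

context pair_graph
begin

lemma awalk_reverse: "awalk x p y \<Longrightarrow> \<exists>q. awalk y q x \<and> length q = length p"
proof (induction p arbitrary: x)
  case Nil
  then show ?case by (auto simp: awalk_Nil_iff intro!: exI[of _ "[]"])
next
  case (Cons e p)
  then have e: "e \<in> parcs G" "fst e = x" and "awalk (snd e) p y" by (auto simp: awalk_Cons_iff)
  then obtain q where q: "awalk y q (snd e)" "length q = length p" using Cons.IH by blast
  have "(snd e, fst e) \<in> parcs G" using e(1) arcs_symmetric by simp
  then have "awalk (snd e) [(snd e, x)] x" using arc_implies_awalk e(2) by fastforce
  then have "awalk y (q @ [(snd e, x)]) x" using q(1) awalk_appendI by blast
  then show ?case using q(2) by (intro exI[of _ "q @ [(snd e, x)]"]) simp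
qed

lemma gdist_le: "awalk x p y \<Longrightarrow> gdist G x y \<le> length p"
  unfolding gdist_def by (rule Least_le) auto

lemma gdist_awalk:
  assumes "connected G" "x \<in> pverts G" "y \<in> pverts G"
  shows "\<exists>p. awalk x p y \<and> length p = gdist G x y"
proof -
  have "strongly_connected G"
    using symmetric_connected_imp_strongly_connected assms(1) sym_arcs by blast
  then have "x \<rightarrow>\<^sup>*\<^bsub>G\<^esub> y" using assms(2,3) by (auto simp: strongly_connected_def)
  then obtain p where "awalk x p y" using reachable_awalk by auto
  then have "\<exists>n p. awalk x p y \<and> length p = n" by blast
  then show ?thesis unfolding gdist_def by (rule LeastI_ex)
qed

lemma gdist_sym:
  assumes "connected G" "x \<in> pverts G" "y \<in> pverts G"
  shows "gdist G x y = gdist G y x"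
proof -
  have "gdist G x y \<le> gdist G y x" if "x \<in> pverts G" "y \<in> pverts G" for x y
    using gdist_awalk[OF assms(1) that(2,1)] awalk_reverse gdist_le by metis
  then show ?thesis using assms(2,3) by (blast intro: antisym)
qed

lemma gdist_step:
  assumes "connected G" "x \<in> pverts G" "(y, z) \<in> parcs G"
  shows "gdist G x z \<le> gdist G x y + 1"
proof -
  obtain p where p: "awalk x p y" "length p = gdist G x y"
    using gdist_awalk[OF assms(1,2)] assms(3) in_arcsD1 by blast
  have "awalk y [(y, z)] z" using arc_implies_awalk[OF assms(3)] by simp
  then have "awalk x (p @ [(y, z)]) z" using p(1) awalk_appendI by blast
  from gdist_le[OF this] show ?thesis using p(2) by simp
qed

lemma gdist_pred:
  assumes "connected G" "x \<in> pverts G" "y \<in> pverts G" "gdist G x y = Suc n"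
  shows "\<exists>z. (z, y) \<in> parcs G \<and> gdist G x z = n"
proof -
  obtain p where p: "awalk x p y" "length p = Suc n" using gdist_awalk[OF assms(1-3)] assms(4) by auto
  then obtain q e where qe: "p = q @ [e]" "length q = n" by (cases p rule: rev_cases) auto
  have w: "awalk x q (fst e)" "e \<in> parcs G" "snd e = y"
    using p(1) unfolding qe(1) by (auto simp: awalk_append_iff awalk_Cons_iff awalk_Nil_iff)
  then have "(fst e, y) \<in> parcs G" by (metis prod.collapse)
  moreover have "gdist G x (fst e) \<le> n" using gdist_le[OF w(1)] qe(2) by simp
  moreover have "Suc n \<le> gdist G x (fst e) + 1"
    using gdist_step[OF assms(1,2) calculation(1)] assms(4) by simp
  ultimately show ?thesis by (metis Suc_eq_plus1 Suc_le_mono le_antisym)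
qed

lemma gdist_eq_0:
  assumes "connected G" "x \<in> pverts G" "y \<in> pverts G"
  shows "gdist G x y = 0 \<longleftrightarrow> x = y"
proof
  assume "gdist G x y = 0"
  then obtain p where "awalk x p y" "length p = 0" using gdist_awalk[OF assms] by auto
  then show "x = y" by (simp add: awalk_Nil_iff)
next
  assume "x = y"
  then have "awalk x [] y" using assms by (simp add: awalk_Nil_iff)
  from gdist_le[OF this] show "gdist G x y = 0" by simp
qed

end

text \<open>Walks are left behind here: the later arguments see the distance only through symmetry,
  the change by at most one along an edge, and the existence of a predecessor.\<close>

lemma distance_regular_drg:
  assumes dr: "distance_regular_with X c a b"
  shows "drg (pverts X) (\<lambda>x y. (x, y) \<in> parcs X) (gdist X) c a b (diam X)"
proof -
  interpret pair_graph X using dr by (simp add: distance_regular_with_def)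
  have con: "connected X" using dr by (simp add: distance_regular_with_def)
  have ne: "pverts X \<noteq> {}" using con by (auto simp: connected_conv)
  let ?D = "{gdist X u v | u v. u \<in> pverts X \<and> v \<in> pverts X}"
  have D: "?D = (\<lambda>(u, v). gdist X u v) ` (pverts X \<times> pverts X)" by auto
  have finD: "finite ?D" unfolding D using pair_finite_verts by simp
  have neD: "?D \<noteq> {}" using ne by auto
  have nb: "{w \<in> pverts X. (y, w) \<in> parcs X \<and> P w} = {w. (y, w) \<in> parcs X \<and> P w}" for y P
    using in_arcsD2 by blast
  show ?thesis
  proof
    show "finite (pverts X)" by (rule pair_finite_verts)
    show "(y, x) \<in> parcs X" if "(x, y) \<in> parcs X" for x y using that arcs_symmetric by simp
    show "(x, x) \<notin> parcs X" for x using pair_no_loops by fastforce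
    show "x \<in> pverts X" if "(x, y) \<in> parcs X" for x y using that in_arcsD1 by blast
    show "\<exists>x\<in>pverts X. \<exists>y\<in>pverts X. gdist X x y = diam X"
      using Max_in[OF finD neD] unfolding diam_def[symmetric] by fastforce
    fix x y assume xy: "x \<in> pverts X" "y \<in> pverts X"
    show "gdist X x y = 0 \<longleftrightarrow> x = y" by (rule gdist_eq_0[OF con xy])
    show "gdist X x y = gdist X y x" by (rule gdist_sym[OF con xy])
    show "\<exists>z. (z, y) \<in> parcs X \<and> gdist X x z = n" if "gdist X x y = Suc n" for n
      by (rule gdist_pred[OF con xy that])
    show "gdist X x y \<le> diam X" unfolding diam_def by (rule Max_ge[OF finD]) (use xy in auto)
    show "card {w. (y, w) \<in> parcs X \<and> gdist X x w + 1 = gdist X x y} = c (gdist X x y)"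
      "card {w. (y, w) \<in> parcs X \<and> gdist X x w = gdist X x y} = a (gdist X x y)"
      "card {w. (y, w) \<in> parcs X \<and> gdist X x w = gdist X x y + 1} = b (gdist X x y)"
      using dr xy unfolding distance_regular_with_def nb[symmetric] by blast+
  next
    show "gdist X x z \<le> gdist X x y + 1" if "x \<in> pverts X" "(y, z) \<in> parcs X" for x y z
      by (rule gdist_step[OF con that])
  qed
qed

lemma neighborhood_cliques:
  assumes "disjoint_union_of_cliques (neighborhood_graph X v) m" and wf: "parcs X \<subseteq> pverts X \<times> pverts X"
  obtains P where "partition_on {w. (v, w) \<in> parcs X} P" "finite P" "card P = m"
    "\<And>z w. (v, z) \<in> parcs X \<Longrightarrow> (v, w) \<in> parcs X \<Longrightarrow>
      (z, w) \<in> parcs X \<longleftrightarrow> z \<noteq> w \<and> (\<exists>C\<in>P. z \<in> C \<and> w \<in> C)"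
proof -
  let ?N = "{w. (v, w) \<in> parcs X}"
  have N: "{w \<in> pverts X. (v, w) \<in> parcs X} = ?N" using wf by blast
  obtain P where P: "partition_on (verts (neighborhood_graph X v)) P" "finite P" "card P = m"
    "arcs_ends (neighborhood_graph X v) = {(u, w). u \<noteq> w \<and> (\<exists>C\<in>P. u \<in> C \<and> w \<in> C)}"
    using assms(1) by (auto simp: disjoint_union_of_cliques_def)
  have V: "verts (neighborhood_graph X v) = ?N" by (simp add: neighborhood_graph_def N)
  have E: "arcs_ends (neighborhood_graph X v) = {(u, w). (u, w) \<in> parcs X \<and> u \<in> ?N \<and> w \<in> ?N}"
    unfolding neighborhood_graph_def N arcs_ends_conv by force
  show ?thesis
  proof (rule that[of P])
    show "partition_on ?N P" using P(1) V by simp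
    fix z w assume "(v, z) \<in> parcs X" "(v, w) \<in> parcs X"
    then have "(z, w) \<in> parcs X \<longleftrightarrow> (z, w) \<in> arcs_ends (neighborhood_graph X v)" unfolding E by simp
    then show "(z, w) \<in> parcs X \<longleftrightarrow> z \<noteq> w \<and> (\<exists>C\<in>P. z \<in> C \<and> w \<in> C)" unfolding P(4) by simp
  qed (use P in auto)
qed

lemma digraph_iso_hamming:
  assumes wf: "pair_wf_digraph X"
    and f: "bij_betw f (pverts X) {l. length l = d \<and> set l \<subseteq> {..<s}}"
    and adj: "\<And>x y. x \<in> pverts X \<Longrightarrow> y \<in> pverts X \<Longrightarrow>
      (x, y) \<in> parcs X \<longleftrightarrow> card {i. i < d \<and> f x ! i \<noteq> f y ! i} = 1"
  shows "digraph_iso X (hamming_graph d s)"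
proof -
  interpret pair_wf_digraph X by (rule wf)
  let ?hom = "\<lparr> iso_verts = f, iso_arcs = (\<lambda>(x, y). (f x, f y)), iso_head = snd, iso_tail = fst \<rparr>"
  let ?V = "{l. length l = d \<and> set l \<subseteq> {..<s}}"
  have inj: "inj_on f (pverts X)" and im: "f ` pverts X = ?V" using f by (auto simp: bij_betw_def)
  have "digraph_isomorphism ?hom"
    unfolding digraph_isomorphism_def
  proof (intro conjI)
    show "inj_on (iso_arcs ?hom) (parcs X)"
    proof (rule inj_onI)
      fix e e' assume e: "e \<in> parcs X" "e' \<in> parcs X" "iso_arcs ?hom e = iso_arcs ?hom e'"
      then have "f (fst e) = f (fst e')" "f (snd e) = f (snd e')" by (simp_all add: case_prod_unfold)
      then have "fst e = fst e'" "snd e = snd e'"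
        using inj_onD[OF inj] arc_fst_in_verts arc_snd_in_verts e(1,2) by blast+
      then show "e = e'" by (rule prod_eqI)
    qed
  qed (use inj wf_digraph_axioms in auto)
  moreover have "with_proj (hamming_graph d s) = app_iso ?hom X"
  proof -
    have "(\<lambda>(x, y). (f x, f y)) ` parcs X
      = {(x, y). x \<in> ?V \<and> y \<in> ?V \<and> card {i. i < d \<and> x ! i \<noteq> y ! i} = 1}" (is "?A = ?B")
    proof
      show "?A \<subseteq> ?B"
      proof
        fix e assume "e \<in> ?A"
        then obtain x y where xy: "(x, y) \<in> parcs X" "e = (f x, f y)" by auto
        then have V: "x \<in> pverts X" "y \<in> pverts X" using in_arcsD1 in_arcsD2 by auto
        then have "f x \<in> ?V" "f y \<in> ?V" using im by blast+
        then show "e \<in> ?B" using adj[OF V] xy by simp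
      qed
      show "?B \<subseteq> ?A"
      proof
        fix e assume "e \<in> ?B"
        then obtain l l' where l: "e = (l, l')" "l \<in> ?V" "l' \<in> ?V" "card {i. i < d \<and> l ! i \<noteq> l' ! i} = 1"
          by blast
        obtain x y where xy: "x \<in> pverts X" "l = f x" "y \<in> pverts X" "l' = f y"
          using l(2,3) unfolding im[symmetric] by blast
        then have "(x, y) \<in> parcs X" using adj l(4) by blast
        then show "e \<in> ?A" using l(1) xy by force
      qed
    qed
    then show ?thesis using im by (simp add: app_iso_def with_proj_def hamming_graph_def Let_def)
  qed
  ultimately show ?thesis unfolding digraph_iso_def by blast
qed

theorem theorem4p7:
  fixes X :: "'a pair_pre_digraph"
    and c a b :: "nat \<Rightarrow> nat"
    and d k \<mu> m t :: nat
    and \<epsilon> :: real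
  assumes "distance_regular_with X c a b"
    and "diam X = d" and "d \<ge> 2"
    and "k = b 0" and "\<mu> = c 2"
    and "\<forall>v\<in>pverts X. disjoint_union_of_cliques (neighborhood_graph X v) m"
    and "\<mu> \<ge> 2"
    and "t \<le> d" and "real (c t) \<le> \<epsilon> * real k" and "real (b t) \<le> \<epsilon> * real k"
    and "theta X 1 \<ge> (1 - \<epsilon>) * real (b 1)"
    and "0 < \<epsilon>" and "\<epsilon> < 1 / (6 * real m ^ 4 * real d)"
  shows "\<exists>s::nat. real s = 1 + real k / real d \<and> digraph_iso X (hamming_graph d s)"
proof -
  let ?V = "pverts X" and ?adj = "\<lambda>x y. (x, y) \<in> parcs X"
  interpret G: drg ?V ?adj "gdist X" c a b d
    using distance_regular_drg[OF assms(1)] assms(2) by simp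
  have wf: "parcs X \<subseteq> ?V \<times> ?V" using G.adj_V G.adj_V2 by auto
  have local: "\<exists>P. partition_on {w. ?adj v w} P \<and> finite P \<and> card P = m \<and>
      (\<forall>z w. ?adj v z \<longrightarrow> ?adj v w \<longrightarrow> (?adj z w \<longleftrightarrow> z \<noteq> w \<and> (\<exists>C\<in>P. z \<in> C \<and> w \<in> C)))"
    if "v \<in> ?V" for v
  proof (rule neighborhood_cliques[OF _ wf, of v m])
    show "disjoint_union_of_cliques (neighborhood_graph X v) m" using assms(6) that by blast
  qed blast
  have trans: "?adj x z" if A: "?adj v x" "?adj v y" "?adj v z" "?adj x y" "?adj y z" "x \<noteq> z" for v x y z
  proof -
    obtain P where P: "partition_on {w. ?adj v w} P"
      "\<forall>z w. ?adj v z \<longrightarrow> ?adj v w \<longrightarrow> (?adj z w \<longleftrightarrow> z \<noteq> w \<and> (\<exists>C\<in>P. z \<in> C \<and> w \<in> C))"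
      using local[OF G.adj_V[OF A(1)]] by blast
    obtain C where C: "C \<in> P" "x \<in> C" "y \<in> C" using P(2) A(1,2,4) by blast
    obtain D where D: "D \<in> P" "y \<in> D" "z \<in> D" using P(2) A(2,3,5) by blast
    have "C = D" using P(1) C D by (auto simp: partition_on_def disjoint_def)
    then show ?thesis using P(2) A(1,3,6) C D by blast
  qed
  obtain v0 where v0: "v0 \<in> ?V" using G.diam_attained by blast
  obtain P where P: "partition_on {w. ?adj v0 w} P" "finite P" "card P = m"
    "\<And>z w. ?adj v0 z \<Longrightarrow> ?adj v0 w \<Longrightarrow> (?adj z w \<longleftrightarrow> z \<noteq> w \<and> (\<exists>C\<in>P. z \<in> C \<and> w \<in> C))"
    using local[OF v0] by auto
  define \<sigma> where "\<sigma> = a 1 + 1"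
  have b0: "b 0 = m * \<sigma>"
  proof -
    have U: "{w. ?adj v0 w} = \<Union>P" using P(1) by (simp add: partition_on_def)
    \<comment> \<open>All blocks have the same size because a block consists of any of its points
      \<open>z\<close> and the neighbours of \<open>v0\<close> at distance 1 from \<open>z\<close>,
      which \<open>a 1\<close> counts.\<close>
    have cardC: "card C = \<sigma>" if C: "C \<in> P" for C
    proof -
      have "C \<noteq> {}" using P(1) C by (auto simp: partition_on_def)
      then obtain z where z: "z \<in> C" by blast
      have zv: "?adj v0 z" using U C z by blast
      let ?A = "{w. ?adj v0 w \<and> gdist X z w = gdist X z v0}"
      have C': "C = insert z ?A"
      proof -
        have "w \<in> C \<longleftrightarrow> w = z \<or> ?adj v0 w \<and> ?adj z w" for w
        proof
          assume "w \<in> C"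
          then show "w = z \<or> ?adj v0 w \<and> ?adj z w" using P(4)[OF zv, of w] U C z by blast
        next
          assume "w = z \<or> ?adj v0 w \<and> ?adj z w"
          moreover have "w \<in> C" if w: "?adj v0 w" "?adj z w"
          proof -
            obtain D where D: "D \<in> P" "z \<in> D" "w \<in> D" using P(4)[OF zv w(1)] w(2) by blast
            then have "D = C" using P(1) C z by (auto simp: partition_on_def disjoint_def)
            then show ?thesis using D by simp
          qed
          ultimately show "w \<in> C" using z by blast
        qed
        moreover have "?adj z w \<longleftrightarrow> gdist X z w = gdist X z v0" if "?adj v0 w" for w
          using G.dst_1[of z w] G.adj_dst[OF G.adj_sym[OF zv]] G.adj_V2[OF zv] G.adj_V2[OF that] by simp
        ultimately show ?thesis by blast
      qed
      have "z \<notin> ?A"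
        using G.adj_dst[OF G.adj_sym[OF zv]] G.adj_V2[OF zv] by simp
      moreover have "card ?A = a 1"
        using G.card_a[OF G.adj_V2[OF zv] v0] G.adj_dst[OF G.adj_sym[OF zv]] by simp
      moreover have "finite ?A" by (rule G.finite_nb)
      ultimately show ?thesis unfolding C' \<sigma>_def by simp
    qed
    have "card (\<Union>P) = (\<Sum>C\<in>P. card C)"
    proof (rule card_Union_disjoint)
      show "pairwise disjnt P" using P(1) by (auto simp: partition_on_def disjoint_def pairwise_def disjnt_def)
      show "finite C" if "C \<in> P" for C
        using that U finite_subset[OF _ G.finite_nb'[of v0], of C] by blast
    qed
    then show ?thesis using cardC P(3) U G.card_nb[OF v0] by simp
  qed
  interpret L: local_cliques ?V ?adj "gdist X" c a b d m \<sigma>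
  proof
    show "a 1 + 1 = \<sigma>" by (simp add: \<sigma>_def)
    show "b 0 = m * \<sigma>" by (rule b0)
    show "2 \<le> d" by (rule assms(3))
    show "2 \<le> c 2" using assms(5,7) by simp
    show "?adj x z" if "?adj v x" "?adj v y" "?adj v z" "?adj x y" "?adj y z" "x \<noteq> z" for v x y z
      by (rule trans[OF that])
  qed
  have m: "2 \<le> m" by (rule L.m2)
  have k: "0 < k" using assms(4) G.b_pos[of 0] assms(3) by simp
  have eps1: "\<epsilon> < 1"
  proof -
    have "1 \<le> real m ^ 4" "1 \<le> real d" using m assms(3) by (simp_all add: one_le_power)
    then have "1 \<le> real m ^ 4 * real d" using mult_mono[of 1 "real m ^ 4" 1 "real d"] by simp
    then have "1 < 6 * real m ^ 4 * real d" by linarith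
    then have "1 / (6 * real m ^ 4 * real d) < 1" by (subst divide_less_eq_1_pos) linarith+
    then show ?thesis using assms(13) by linarith
  qed
  \<comment> \<open>For positive \<open>t\<close> the bound on \<open>c t \<ge> 1\<close> gives
    this. At \<open>t = 0\<close>, where \<open>c t\<close> vanishes, the bound on
    \<open>b 0 = k\<close> contradicts \<open>\<epsilon> < 1\<close>.\<close>
  have epsk: "1 \<le> \<epsilon> * real k"
  proof (cases "t = 0")
    case True
    then have "real k \<le> \<epsilon> * real k" using assms(4,10) by simp
    then show ?thesis using eps1 k by simp
  next
    case False
    then have "1 \<le> c t" using G.c_pos[of t] assms(8) by simp
    then show ?thesis using assms(9) by linarith
  qed
  let ?\<theta> = "theta X 1"
  have \<theta>: "?\<theta> \<in> adj_eigenvalues X" "?\<theta> < real k"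
    using theta_1_less[of X k] G.fin v0 wf G.adj_sym G.adj_irrefl G.card_nb assms(4) k by auto
  obtain h where h: "\<exists>x\<in>?V. h x \<noteq> 0" "\<forall>y\<in>?V. (\<Sum>w | ?adj y w. h w) = ?\<theta> * h y"
    using adj_eigenvalue_function[OF wf \<theta>(1)] by blast
  then obtain x0 where x0: "x0 \<in> ?V" "h x0 \<noteq> 0" by blast
  have ef: "G.eigenfunction ?\<theta> h" using h(2) by (simp add: G.eigenfunction_def)
  have d1: "1 \<le> d" using assms(3) by simp
  obtain r where r: "\<And>x y. x \<in> ?V \<Longrightarrow> y \<in> ?V \<Longrightarrow> (\<Sum>z\<in>?V. r x z * r y z) = G.cosine ?\<theta> (gdist X x y)"
    using G.cosine_gram[OF ef x0 d1] by blast
  interpret R: local_cliques_rep ?V ?adj "gdist X" c a b d m \<sigma> ?\<theta> \<epsilon> "G.cosine ?\<theta>" r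
  proof
    show "G.cosine ?\<theta> 0 = 1" by (rule G.cosine_0)
    show "real (b 0) * G.cosine ?\<theta> 1 = ?\<theta>" by (rule G.cosine_1[OF d1])
    show "real (c i) * G.cosine ?\<theta> (i - 1) + real (a i) * G.cosine ?\<theta> i
        + real (b i) * G.cosine ?\<theta> (i + 1) = ?\<theta> * G.cosine ?\<theta> i" if "1 \<le> i" "i \<le> d" for i
      by (rule G.cosine_rec[OF ef x0 that])
    show "(\<Sum>z\<in>?V. r x z * r y z) = G.cosine ?\<theta> (gdist X x y)" if "x \<in> ?V" "y \<in> ?V" for x y
      by (rule r[OF that])
    show "?\<theta> < real (b 0)" "1 \<le> \<epsilon> * real (b 0)" using \<theta>(2) epsk assms(4) by simp_all
  qed (rule assms)+
  interpret H: hamming_like ?V ?adj "gdist X" c a b d m \<sigma> v0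
    by unfold_locales (rule R.regular_everywhere v0; assumption?)+
  have md: "m = d" by (rule R.m_eq_d)
  obtain f where f: "bij_betw f ?V {l. length l = m \<and> set l \<subseteq> {..<\<sigma> + 1}}"
    "\<And>y y'. y \<in> ?V \<Longrightarrow> y' \<in> ?V \<Longrightarrow> ?adj y y' \<longleftrightarrow> card {i. i < m \<and> f y ! i \<noteq> f y' ! i} = 1"
    using H.hamming_coding[OF P(1,3,2,4)] by blast
  have "digraph_iso X (hamming_graph d (\<sigma> + 1))"
  proof (rule digraph_iso_hamming)
    show "pair_wf_digraph X" by unfold_locales (use wf in auto)
  qed (use f md in auto)
  moreover have "real (\<sigma> + 1) = 1 + real k / real d" using b0 md assms(3,4) by simp
  ultimately show ?thesis by blast
qed

end
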